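(* Let $\mathcal{E}_{\rm EVEN}=\mathcal{E}\cap K_{(2,2)}$ be the even part of the planar $3$-colorable subgroup $\mathcal{E}$ of Thompson's group $F$. Then $\mathcal{E}_{\rm EVEN}$ is a closed subgroup of $F$.
   Context: Thompson's group $F$ is the group of piecewise linear homeomorphisms of $[0,1]$ differentiable except at finitely many dyadic rationals, with all slopes powers of $2$; the product is $(f\cdot g)(t)=g(f(t))$. $K_{(2,2)}=\{f\in F: \log_2 f'(0)\in 2\mathbb{Z},\ \log_2 f'(1)\in 2\mathbb{Z}\}$. Closed subgroups: if $g\in F$ fixes a dyadic rational $\alpha\in(0,1)$, the components of $g$ at $\alpha$ are the functions $g_1,g_2$ with $g_1=g$ on $[0,\alpha]$, $g_1={\rm id}$ on $[\alpha,1]$, and $g_2={\rm id}$ on $[0,\alpha]$, $g_2=g$ on $[\alpha,1]$. A subgroup $H\le F$ is closed if for every $h\in H$ and every dyadic rational $\alpha\in(0,1)$ fixed by $h$, both components of $h$ at $\alpha$ belong to $H$. Tree diagrams: a tree diagram is a pair $(T_+,T_-)$ of finite planar rooted binary trees with the same number $n$ of leaves. Vertices are finite binary words (root = empty word, $v0$ and $v1$ = left and right child of $v$). It represents the element of $F$ sending $.\alpha_k\gamma$ to $.\beta_k\gamma$ for each $k$ and each infinite binary word $\gamma$, where $\alpha_k,\beta_k$ are the $k$-th leaves (from left to right) of $T_+,T_-$. Every element of $F$ is so represented, uniquely up to inserting/deleting pairs of opposing carets. One draws $T_-$ upside down below $T_+$ and identifies the $k$-th leaves of the two trees. Planar $3$-colorable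 subgroup $\mathcal{E}$: ignoring edges sprouting upward/downward from the two roots, the diagram partitions the plane into regions: the outer region $R_0=R_n$ and, for $1\le i\le n-1$, the region $R_i$ between the $i$-th and $(i+1)$-th leaves. If $v$ is a non-root vertex of $T_+$ or $T_-$ whose descendant leaves are numbers $p+1,\dots,q$, the edge from $v$ to its parent separates $R_p$ from $R_q$. $\mathcal{E}$ is the subgroup of elements whose plane partition is $3$-colorable: there is a map $c$ from the regions to $\mathbb{Z}_3$ giving different colors to regions sharing an edge, i.e. $c(R_p)\neq c(R_q)$ for each such $v$. This does not depend on the tree diagram chosen. *)

theory Defs
  imports "HOL-Analysis.Analysis" "HOL-Algebra.Group" "HOL-Library.Stream" "HOL-Library.Sublist"
begin

section \<open>Thompson's group\<close>

text \<open>
  Homeomorphisms of [0,1] are represented by functions on the reals that are the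
  identity outside [0,1], so that each of them has exactly one representative.  The set
  \<open>B\<close> contains the points of non-differentiability; the slopes are positive, so
  the endpoints are fixed.  \<^const>\<open>dyadics\<close> only contains nonnegative numbers, which is
  no restriction inside [0,1].
\<close>

definition thompson_elements :: "(real \<Rightarrow> real) set" where
  "thompson_elements =
    {f. (\<forall>t. t \<notin> {0..1} \<longrightarrow> f t = t) \<and>
        (\<exists>g. homeomorphism {0..1} {0..1} f g) \<and>
        (\<exists>B. finite B \<and> B \<subseteq> dyadics \<inter> {0..1} \<and>
          (\<forall>a b. 0 \<le> a \<and> a < b \<and> b \<le> 1 \<and> {a<..<b} \<inter> B = {} \<longrightarrow>
            (\<exists>(k::int) d. \<forall>t\<in>{a..b}. f t = 2 powi k * t + d)))}"

definition thompson_F :: "(real \<Rightarrow> real) monoid" where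
  "thompson_F = \<lparr>carrier = thompson_elements, mult = (\<lambda>f g t. g (f t)), one = (\<lambda>t. t)\<rparr>"

definition K22 :: "(real \<Rightarrow> real) set" where
  "K22 = {f \<in> carrier thompson_F.
    (\<exists>D (m::int). (f has_real_derivative D) (at 0 within {0..1}) \<and> log 2 D = 2 * of_int m) \<and>
    (\<exists>D (m::int). (f has_real_derivative D) (at 1 within {0..1}) \<and> log 2 D = 2 * of_int m)}"


section \<open>Closed subgroups\<close>

definition left_component :: "real \<Rightarrow> (real \<Rightarrow> real) \<Rightarrow> real \<Rightarrow> real" where
  "left_component \<alpha> g t = (if t \<le> \<alpha> then g t else t)"

definition right_component :: "real \<Rightarrow> (real \<Rightarrow> real) \<Rightarrow> real \<Rightarrow> real" where
  "right_component \<alpha> g t = (if t \<le> \<alpha> then t else g t)"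

definition closed_subgroup_F :: "(real \<Rightarrow> real) set \<Rightarrow> bool" where
  "closed_subgroup_F H \<longleftrightarrow>
    subgroup H thompson_F \<and>
    (\<forall>h\<in>H. \<forall>\<alpha>\<in>dyadics \<inter> {0<..<1}. h \<alpha> = \<alpha> \<longrightarrow>
      left_component \<alpha> h \<in> H \<and> right_component \<alpha> h \<in> H)"


section \<open>Tree diagrams\<close>

text \<open>
  A vertex is the binary word leading to it from the root, where \<^const>\<open>False\<close> stands for
  the digit 0 (left child) and \<^const>\<open>True\<close> for the digit 1 (right child).
\<close>

datatype btree = Tip | Caret btree btree

primrec vertices :: "btree \<Rightarrow> bool list set" where
  "vertices Tip = {[]}"
| "vertices (Caret l r) = insert [] ((#) False ` vertices l \<union> (#) True ` vertices r)"

primrec leaves :: "btree \<Rightarrow> bool list list" where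
  "leaves Tip = [[]]"
| "leaves (Caret l r) = map ((#) False) (leaves l) @ map ((#) True) (leaves r)"

definition bin_val :: "bool stream \<Rightarrow> real" where
  "bin_val s = (\<Sum>i. of_bool (s !! i) / 2 ^ Suc i)"

text \<open>The trees \<open>T\<close> and \<open>U\<close> are the \<open>T\<^sub>+\<close> and \<open>T\<^sub>-\<close> of a tree diagram.\<close>

definition represents :: "btree \<Rightarrow> btree \<Rightarrow> (real \<Rightarrow> real) \<Rightarrow> bool" where
  "represents T U f \<longleftrightarrow>
    length (leaves T) = length (leaves U) \<and>
    (\<forall>k < length (leaves T). \<forall>\<gamma>.
      f (bin_val (leaves T ! k @- \<gamma>)) = bin_val (leaves U ! k @- \<gamma>))"


section \<open>The planar 3-colorable subgroup\<close>

text \<open>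
  With leaves counted from 0, the descendant leaves of \<open>v\<close> having numbers \<open>p+1,\<dots>,q\<close>
  in the count from 1 are those with indices \<open>p,\<dots>,q-1\<close>.
\<close>

definition separates :: "btree \<Rightarrow> nat \<Rightarrow> nat \<Rightarrow> bool" where
  "separates T p q \<longleftrightarrow> p < q \<and>
    (\<exists>v\<in>vertices T. v \<noteq> [] \<and> {k. k < length (leaves T) \<and> prefix v (leaves T ! k)} = {p..<q})"

text \<open>
  Regions are indexed by \<open>0,\<dots>,n\<close>, where \<open>0\<close> and \<open>n\<close> are both indices of the outer region;
  \<open>3\<close> is the type of integers modulo 3.
\<close>

definition three_colorable :: "btree \<Rightarrow> btree \<Rightarrow> bool" where
  "three_colorable T U \<longleftrightarrow>
    (\<exists>c :: nat \<Rightarrow> 3. c 0 = c (length (leaves T)) \<and>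
      (\<forall>p q. separates T p q \<or> separates U p q \<longrightarrow> c p \<noteq> c q))"

text \<open>
  Colorability does not depend on the diagram representing \<open>f\<close>, so an existential
  quantifier over the diagrams is used.
\<close>

definition planar_3_colorable :: "(real \<Rightarrow> real) set" where
  "planar_3_colorable = {f \<in> carrier thompson_F.
    \<exists>T U. represents T U f \<and> three_colorable T U}"

definition E_EVEN :: "(real \<Rightarrow> real) set" where
  "E_EVEN = planar_3_colorable \<inter> K22"

end

(*
  In a colored tree the third edge at a non-root caret has the color difference opposite to the two
  other edges, while at the root the two differences cancel.  Hence the coloring of the plane is
  determined up to a global sign by the parity of |v| + (first digit of v) at the leaves v, and a
  diagram is 3-colorable iff these parities agree, up to one global flip, at corresponding leaves.
  The first leaves have parity log_2 f'(0), so the even part consists of the diagrams without flip.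
  In terms of f: wherever f has right slope 2^k at t, k is even iff t and f(t) lie in the same half
  of [0,1).  This condition on germs is stable under composition, inversion and gluing at a common
  fixed point.
*)
theory Submission
  imports Defs
begin

section \<open>Binary words and trees\<close>

text \<open>\<open>leaf_sign\<close> writes the parity at a leaf as a unit modulo 3: up to a common
  factor it is the jump of the color across that leaf. A coloring is therefore a partial sum of
  signs. The conditions at inner vertices come from (-1) + (-1) = 1: opening a non-root leaf into a
  caret turns the summand s into -s and -s, with the same sum.

  Colorability is existential in the diagram. One colorable diagram yields the condition on germs,
  and under that condition every diagram is colorable; so the converse needs some diagram for each
  element of F. Supplying it is the longest part: a grid is refined until all its cells have
  standard dyadic images, and a tree is then recovered from a tiling of [0,1] by such images.

  Germs are taken on the right because [0,1) is the disjoint union of the half-open leaf intervals,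
  on each of which the first digit of the leaf decides the half. The slope at 1 is recovered from
  right germs just below 1, where t and f(t) both lie in the right half.\<close>

primrec word_val :: "bool list \<Rightarrow> real" where
  "word_val [] = 0"
| "word_val (b # w) = (of_bool b + word_val w) / 2"

lemma word_val_nonneg: "0 \<le> word_val w"
  by (induction w) auto

lemma word_end_Cons:
  "word_val (b # w) + 1 / 2 ^ length (b # w) = (of_bool b + (word_val w + 1 / 2 ^ length w)) / 2"
  by (simp add: field_simps)

lemma word_val_end_le: "word_val w + 1 / 2 ^ length w \<le> 1"
proof (induction w)
  case (Cons b w)
  then show ?case unfolding word_end_Cons by (cases b) auto
qed simp

text \<open>Turns the first digit of a leaf into a condition on points. The interval has to be
  half-open: the closed interval of a word starting with 0 may contain 1/2.\<close>

lemma half_le_word_interval_iff: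
  assumes "w \<noteq> []" "word_val w \<le> t" "t < word_val w + 1 / 2 ^ length w"
  shows "1 / 2 \<le> t \<longleftrightarrow> hd w"
proof -
  obtain b v where w: "w = b # v" using assms(1) by (cases w) auto
  have "t < 1 / 2" if "\<not> b"
    using assms(3) word_val_end_le[of v] that unfolding w word_end_Cons by simp
  moreover have "1 / 2 \<le> t" if b
    using assms(2) word_val_nonneg[of v] that by (simp add: w field_simps)
  ultimately show ?thesis using w by fastforce
qed

lemma ex_word_val:
  assumes "i < 2 ^ n"
  shows "\<exists>w. length w = n \<and> word_val w = real i / 2 ^ n"
  using assms
proof (induction n arbitrary: i)
  case (Suc n)
  show ?case
  proof (cases "i < 2 ^ n")
    case True
    then obtain w where "length w = n" "word_val w = real i / 2 ^ n" using Suc.IH by blast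
    then show ?thesis by (intro exI[of _ "False # w"]) simp
  next
    case False
    then have "i - 2 ^ n < 2 ^ n" using Suc.prems by simp
    then obtain w where "length w = n" "word_val w = real (i - 2 ^ n) / 2 ^ n" using Suc.IH by blast
    moreover have "real (i - 2 ^ n) = real i - 2 ^ n" using False by (simp add: of_nat_diff)
    ultimately show ?thesis by (intro exI[of _ "True # w"]) (simp add: field_simps)
  qed
qed simp

section \<open>Infinite binary words as points of [0,1]\<close>

lemma bin_val_summable: "summable (\<lambda>i. of_bool (s !! i) / 2 ^ Suc i :: real)"
proof (rule summable_comparison_test')
  show "summable (\<lambda>i. (1/2) ^ Suc i :: real)"
    using power_half_series by (rule sums_summable)
  show "norm (of_bool (s !! n) / 2 ^ Suc n :: real) \<le> (1/2) ^ Suc n" if "n \<ge> 0" for n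
    by (simp add: power_one_over divide_simps)
qed

lemma bin_val_Cons: "bin_val (b ## s) = (of_bool b + bin_val s) / 2"
proof -
  have "bin_val (b ## s) = (\<Sum>i. of_bool ((b ## s) !! Suc i) / 2 ^ Suc (Suc i)) + of_bool b / 2"
    unfolding bin_val_def using suminf_split_head[OF bin_val_summable[of "b ## s"]] by simp
  also have "(\<Sum>i. of_bool ((b ## s) !! Suc i) / 2 ^ Suc (Suc i)) = (\<Sum>i. (of_bool (s !! i) / 2 ^ Suc i) / 2 :: real)"
    by (simp add: field_simps)
  also have "\<dots> = bin_val s / 2"
    unfolding bin_val_def using suminf_divide[OF bin_val_summable[of s], of 2] by simp
  finally show ?thesis by (simp add: field_simps)
qed

lemma bin_val_bounds: "0 \<le> bin_val s" "bin_val s \<le> 1"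
proof -
  show "0 \<le> bin_val s"
    unfolding bin_val_def by (rule suminf_nonneg[OF bin_val_summable]) auto
  have "bin_val s \<le> (\<Sum>i. (1/2) ^ Suc i)"
    unfolding bin_val_def using power_half_series
    by (intro suminf_le bin_val_summable) (auto simp: power_one_over divide_simps dest: sums_summable)
  also have "\<dots> = 1" using power_half_series by (rule sums_unique[symmetric])
  finally show "bin_val s \<le> 1" .
qed

lemma bin_val_shift: "bin_val (w @- s) = word_val w + bin_val s / 2 ^ length w"
  by (induction w) (auto simp: bin_val_Cons field_simps)

text \<open>Binary expansion by the doubling map, each digit recording whether the iterate has
  reached 1/2. The endpoint 1 is fixed by \<open>dbl\<close> and gets the expansion 111..., so
  closed leaf intervals are covered completely.\<close>

lemma ex_bin_val:
  assumes "0 \<le> u" "u \<le> 1"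
  shows "\<exists>s. bin_val s = u"
proof -
  define dbl :: "real \<Rightarrow> real" where "dbl x = (if x \<ge> 1/2 then 2 * x - 1 else 2 * x)" for x
  define s where "s = smap (\<lambda>x. x \<ge> 1/2) (siterate dbl u)"
  have rng: "0 \<le> (dbl ^^ n) u \<and> (dbl ^^ n) u \<le> 1" for n
    by (induction n) (use assms in \<open>auto simp: dbl_def\<close>)
  have nth: "s !! n \<longleftrightarrow> (dbl ^^ n) u \<ge> 1/2" for n by (simp add: s_def)
  \<comment> \<open>After n digits the remainder is the n-th iterate divided by 2^n; it tends to 0
    because the iterates stay in [0,1].\<close>
  have part: "(\<Sum>i<n. of_bool (s !! i) / 2 ^ Suc i) = u - (dbl ^^ n) u / 2 ^ n" for n
    proof (induction n)
    case (Suc n)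
    have "(dbl ^^ Suc n) u = 2 * (dbl ^^ n) u - of_bool (s !! n)"
      unfolding nth by (simp add: dbl_def)
    then show ?case using Suc by (simp add: field_simps)
  qed simp
  have "(\<lambda>n. (dbl ^^ n) u / 2 ^ n) \<longlonglongrightarrow> 0"
  proof (rule Lim_null_comparison)
    show "\<forall>\<^sub>F n in sequentially. norm ((dbl ^^ n) u / 2 ^ n) \<le> (1/2) ^ n"
      using rng by (intro always_eventually allI) (simp add: power_one_over divide_simps)
    show "(\<lambda>n. (1/2) ^ n :: real) \<longlonglongrightarrow> 0" by (rule LIMSEQ_power_zero) simp
  qed
  then have "(\<lambda>n. u - (dbl ^^ n) u / 2 ^ n) \<longlonglongrightarrow> u - 0" by (intro tendsto_intros)
  then have "(\<lambda>i. of_bool (s !! i) / 2 ^ Suc i) sums u" unfolding sums_def part by simp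
  then have "bin_val s = u" unfolding bin_val_def by (rule sums_unique[symmetric])
  then show ?thesis ..
qed

section \<open>Leaf intervals and the affine pieces of a represented map\<close>

lemma represents_affine:
  assumes "represents T U f" "k < length (leaves T)"
    and "word_val (leaves T ! k) \<le> x" "x \<le> word_val (leaves T ! k) + 1 / 2 ^ length (leaves T ! k)"
  shows "f x = word_val (leaves U ! k) +
    2 powi (int (length (leaves T ! k)) - int (length (leaves U ! k))) * (x - word_val (leaves T ! k))"
proof -
  let ?a = "leaves T ! k" and ?b = "leaves U ! k"
  \<comment> \<open>The position of x inside the leaf interval, rescaled to [0,1]. Its expansion is
    the tail that the diagram keeps while it exchanges the leaves, so only the scale
    changes.\<close>
  define u where "u = (x - word_val ?a) * 2 ^ length ?a"
  have "0 \<le> u" "u \<le> 1" using assms(3,4) by (auto simp: u_def field_simps)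
  then obtain s where s: "bin_val s = u" using ex_bin_val by blast
  have x: "x = bin_val (?a @- s)" by (simp add: bin_val_shift s u_def)
  have "f x = bin_val (?b @- s)" unfolding x using assms(1,2) by (simp add: represents_def)
  then show ?thesis by (simp add: bin_val_shift s u_def power_int_diff)
qed

lemma ex_leaf_interval:
  assumes "0 \<le> t" "t < 1"
  shows "\<exists>k < length (leaves T). word_val (leaves T ! k) \<le> t \<and>
    t < word_val (leaves T ! k) + 1 / 2 ^ length (leaves T ! k)"
proof -
  have "\<exists>w \<in> set (leaves T). word_val w \<le> t \<and> t < word_val w + 1 / 2 ^ length w"
    using assms
  proof (induction T arbitrary: t)
    case (Caret l r)
    show ?case
    proof (cases "t < 1 / 2")
      case True
      then obtain w where "w \<in> set (leaves l)" "word_val w \<le> 2 * t" "2 * t < word_val w + 1 / 2 ^ length w"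
        using Caret.IH(1)[of "2 * t"] Caret.prems by auto
      then show ?thesis by (intro bexI[of _ "False # w"]) (auto simp: field_simps)
    next
      case False
      then obtain w where "w \<in> set (leaves r)" "word_val w \<le> 2 * t - 1" "2 * t - 1 < word_val w + 1 / 2 ^ length w"
        using Caret.IH(2)[of "2 * t - 1"] Caret.prems by auto
      then show ?thesis by (intro bexI[of _ "True # w"]) (auto simp: field_simps)
    qed
  qed simp
  then show ?thesis by (metis in_set_conv_nth)
qed

section \<open>Leaves of a tree, and trees from tilings of [0,1]\<close>

lemma length_leaves_pos: "0 < length (leaves T)"
  by (induction T) auto

lemma word_val_first_leaf: "word_val (leaves T ! 0) = 0"
  by (induction T) (use length_leaves_pos in \<open>auto simp: nth_append\<close>)

lemma leaf_not_Nil: "k < length (leaves T) \<Longrightarrow> length (leaves T) \<noteq> 1 \<Longrightarrow> leaves T ! k \<noteq> []"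
  by (cases T) (auto simp: nth_append)

lemma length_leaves_eq_1: "length (leaves T) = 1 \<Longrightarrow> T = Tip"
proof (cases T)
  case (Caret l r)
  then show "length (leaves T) = 1 \<Longrightarrow> T = Tip"
    using length_leaves_pos[of l] length_leaves_pos[of r] by simp
qed simp

text \<open>A tiling of [a,b], from left to right, by the dyadic intervals belonging to the words:
  what the leaves of a tree look like when the tree is forgotten.\<close>

primrec word_chain :: "real \<Rightarrow> bool list list \<Rightarrow> real \<Rightarrow> bool" where
  "word_chain a [] b \<longleftrightarrow> a = b"
| "word_chain a (w # ws) b \<longleftrightarrow> word_val w = a \<and> word_chain (a + 1 / 2 ^ length w) ws b"

lemma word_chain_append:
  "word_chain a (vs @ ws) b \<longleftrightarrow> (\<exists>c. word_chain a vs c \<and> word_chain c ws b)"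
  by (induction vs arbitrary: a) auto

text \<open>Prefixing the digit d acts on intervals as x -> (d + x)/2 and so carries tilings to
  tilings. It is used backwards, to strip first digits.\<close>

lemma word_chain_map_Cons:
  "word_chain ((of_bool d + a) / 2) (map ((#) d) ws) ((of_bool d + b) / 2) \<longleftrightarrow> word_chain a ws b"
proof (induction ws arbitrary: a)
  case (Cons w ws)
  have "(of_bool d + a) / 2 + 1 / 2 ^ length (d # w) = (of_bool d + (a + 1 / 2 ^ length w)) / 2"
    by (simp add: field_simps)
  then have "word_chain ((of_bool d + a) / 2 + 1 / 2 ^ length (d # w)) (map ((#) d) ws) ((of_bool d + b) / 2)
    \<longleftrightarrow> word_chain (a + 1 / 2 ^ length w) ws b"
    using Cons[of "a + 1 / 2 ^ length w"] by (simp only:)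
  moreover have "word_val (d # w) = (of_bool d + a) / 2 \<longleftrightarrow> word_val w = a" by simp
  ultimately show ?case by (simp only: list.map word_chain.simps)
qed auto

lemma word_chain_ge: "word_chain a ws b \<Longrightarrow> w \<in> set ws \<Longrightarrow> a \<le> word_val w"
proof (induction ws arbitrary: a)
  case (Cons v ws)
  show ?case
  proof (cases "w = v")
    case False
    then have "a + 1 / 2 ^ length v \<le> word_val w" using Cons by simp
    moreover have "a \<le> a + 1 / 2 ^ length v" by simp
    ultimately show ?thesis by (rule order_trans[rotated])
  qed (use Cons.prems in simp)
qed simp

lemma word_chain_mono: "word_chain a ws b \<Longrightarrow> a \<le> b"
proof (induction ws arbitrary: a)
  case (Cons v ws)
  then have "a + 1 / 2 ^ length v \<le> b" by auto
  moreover have "a \<le> a + 1 / 2 ^ length v" by simp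
  ultimately show ?case by (meson order_trans)
qed simp

lemma word_chain_end_le:
  "word_chain a ws b \<Longrightarrow> ws \<noteq> [] \<Longrightarrow> (\<And>w. w \<in> set ws \<Longrightarrow> word_val w + 1 / 2 ^ length w \<le> c) \<Longrightarrow> b \<le> c"
proof (induction ws arbitrary: a)
  case (Cons v ws)
  show ?case
  proof (cases "ws = []")
    case True
    then show ?thesis using Cons.prems by auto
  next
    case False
    then show ?thesis using Cons.IH[of "a + 1 / 2 ^ length v"] Cons.prems by auto
  qed
qed simp

lemma word_chain_less:
  assumes "word_chain a ws b" "ws \<noteq> []"
  shows "a < b"
proof -
  obtain w vs where "ws = w # vs" using assms(2) by (cases ws) auto
  then have "word_chain (a + 1 / 2 ^ length w) vs b" using assms(1) by simp
  then have "a + 1 / 2 ^ length w \<le> b" by (rule word_chain_mono)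
  moreover have "a < a + 1 / 2 ^ length w" by simp
  ultimately show ?thesis by linarith
qed

text \<open>Induction on a bound for the word lengths. Either the empty word is the only tile, or
  the tiling breaks at 1/2 and stripping the first digits leaves a tiling of [0,1] for each
  subtree.\<close>

lemma word_chain_imp_tree:
  assumes "word_chain 0 ws 1"
  shows "\<exists>T. leaves T = ws"
proof -
  define m where "m = sum_list (map length ws)"
  have "length w \<le> m" if "w \<in> set ws" for w
    unfolding m_def using that by (intro member_le_sum_list) auto
  with assms show ?thesis
  proof (induction m arbitrary: ws)
    case 0
    then obtain w vs where ws: "ws = w # vs" by (cases ws) auto
    with 0 have w: "w = []" by auto
    have "vs = []"
    proof (cases vs)
      case (Cons v us)
      then have "v = []" "word_val v = 1" using 0 ws w by auto
      then show ?thesis by simp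
    qed simp
    then show ?case using ws w by (intro exI[of _ Tip]) simp
  next
    case (Suc m)
    show ?case
    proof (cases "[] \<in> set ws")
      case True
      then obtain us vs where ws: "ws = us @ [] # vs" by (meson split_list)
      then obtain c where c: "word_chain 0 us c" "c = 0" "word_chain 1 vs 1"
        using Suc.prems(1) by (auto simp: word_chain_append)
      \<comment> \<open>The empty word fills [0,1] by itself, and a further tile would have positive
        length.\<close>
      have "us = []" "vs = []" using word_chain_less[OF c(1)] word_chain_less[OF c(3)] c(2) by auto
      then show ?thesis using ws by (intro exI[of _ Tip]) simp
    next
      case False
      \<comment> \<open>A tiling that has reached a word starting with 1 has passed 1/2, so the cut
        at the first such word separates the two kinds. The cut point \<open>c\<close> turns out to
        be 1/2.\<close>
      define us vs where "us = takeWhile (\<lambda>w. \<not> hd w) ws" and "vs = dropWhile (\<lambda>w. \<not> hd w) ws"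
      have ws: "ws = us @ vs" by (simp add: us_def vs_def)
      then obtain c where c: "word_chain 0 us c" "word_chain c vs 1"
        using Suc.prems(1) by (auto simp: word_chain_append)
      have ne: "w \<noteq> []" if "w \<in> set ws" for w using that False by auto
      have us_hd: "\<not> hd w" if "w \<in> set us" for w
        using that unfolding us_def by (auto dest: set_takeWhileD)
      have us_end: "word_val w + 1 / 2 ^ length w \<le> 1 / 2" if w: "w \<in> set us" for w
      proof -
        obtain v where "w = False # v" using us_hd[OF w] ne[of w] w ws by (cases w) auto
        then show ?thesis using word_val_end_le[of v] word_end_Cons[of False v] by simp
      qed
      \<comment> \<open>If \<open>us\<close> is empty, then \<open>c\<close> is 0. In either case
        \<open>c\<close> is below 1, so \<open>vs\<close> is nonempty and its first word forces
        \<open>c\<close> to be at least 1/2.\<close>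
      have c_le: "c \<le> 1 / 2" using word_chain_end_le[OF c(1) _ us_end] c(1) by (cases "us = []") auto
      then obtain v vs' where v: "vs = v # vs'" using c(2) by (cases vs) auto
      have "hd v" using v hd_dropWhile[of "\<lambda>w. \<not> hd w" ws] unfolding vs_def by (metis list.distinct(1) list.sel(1))
      then obtain v' where "v = True # v'" using ne[of v] ws v by (cases v) auto
      then have "1 / 2 \<le> c" using c(2) v word_val_nonneg[of v'] by (simp add: field_simps)
      with c_le have ceq: "c = 1 / 2" by simp
      have vs_hd: "hd w" if w: "w \<in> set vs" for w
      proof (rule ccontr)
        assume "\<not> hd w"
        then obtain w' where "w = False # w'" using ne[of w] w ws by (cases w) auto
        moreover have "1 / 2 \<le> word_val w" using word_chain_ge[OF c(2) w] ceq by simp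
        moreover have "word_val w' < 1"
          using word_val_end_le[of w'] zero_less_divide_1_iff[of "2 ^ length w' :: real"] by (smt (verit) zero_less_power)
        ultimately show False by simp
      qed
      have "((#) False \<circ> tl) w = w" if "w \<in> set us" for w
        using us_hd[OF that] ne[of w] that ws by (cases w) auto
      then have us_map: "us = map ((#) False) (map tl us)"
        by (simp add: map_idI)
      have "((#) True \<circ> tl) w = w" if "w \<in> set vs" for w
        using vs_hd[OF that] ne[of w] that ws by (cases w) auto
      then have vs_map: "vs = map ((#) True) (map tl vs)"
        by (simp add: map_idI)
      have "word_chain 0 (map tl us) 1"
        using c(1) word_chain_map_Cons[of False 0 "map tl us" 1] ceq unfolding us_map[symmetric] by simp
      moreover have "length w \<le> m" if "w \<in> set (map tl us)" for w
        using that Suc.prems(2) ws by fastforce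
      ultimately obtain L where L: "leaves L = map tl us" using Suc.IH by blast
      have "word_chain 0 (map tl vs) 1"
        using c(2) word_chain_map_Cons[of True 0 "map tl vs" 1] ceq unfolding vs_map[symmetric] by simp
      moreover have "length w \<le> m" if "w \<in> set (map tl vs)" for w
        using that Suc.prems(2) ws by fastforce
      ultimately obtain R where R: "leaves R = map tl vs" using Suc.IH by blast
      show ?thesis
        by (intro exI[of _ "Caret L R"]) (simp only: leaves.simps L R us_map[symmetric] vs_map[symmetric] ws)
    qed
  qed
qed

lemma ex_tree_of_partition:
  assumes "x 0 = 0" "x n = 1"
    and "\<And>i. i < n \<Longrightarrow> word_val (w i) = x i"
    and "\<And>i. i < n \<Longrightarrow> x (Suc i) = x i + 1 / 2 ^ length (w i)"
  shows "\<exists>T. leaves T = map w [0..<n]"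
proof (rule word_chain_imp_tree)
  have "m \<le> n \<Longrightarrow> word_chain 0 (map w [0..<m]) (x m)" for m
    by (induction m) (use assms in \<open>auto simp: word_chain_append\<close>)
  then show "word_chain 0 (map w [0..<n]) 1" using assms(2) by fastforce
qed

section \<open>Colorings\<close>

text \<open>On \<^term>\<open>[]\<close> the value is meaningless; it only occurs for the trivial diagram.\<close>

definition leaf_sign :: "bool list \<Rightarrow> 3" where
  "leaf_sign w = (if even (length w) \<longleftrightarrow> hd w then - 1 else 1)"

text \<open>Applied at each caret: two children of opposite sign add up to the sign of their
  parent.\<close>

lemma minus_one_double_3: "(- 1 :: 3) + - 1 = 1"
  by simp

lemma leaf_sign_eq_iff:
  "leaf_sign v = leaf_sign w \<longleftrightarrow> ((even (length v) \<longleftrightarrow> hd v) \<longleftrightarrow> (even (length w) \<longleftrightarrow> hd w))"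
  by (auto simp: leaf_sign_def)

text \<open>The sum is unchanged when a leaf is opened into a caret, so it has the value it takes on
  the one-leaf tree.\<close>

lemma sum_leaves_sign: "(\<Sum>w\<leftarrow>leaves T. (- 1) ^ length w) = (1 :: 3)"
proof (induction T)
  case (Caret l r)
  have "(\<Sum>w\<leftarrow>leaves S. (- 1) ^ length (b # w)) = - (\<Sum>w\<leftarrow>leaves S. (- 1 :: 3) ^ length w)" for S and b :: bool
    by (simp add: uminus_sum_list_map comp_def)
  with Caret show ?case using minus_one_double_3 by (simp add: comp_def)
qed simp

text \<open>The same count inside the subtree at v: its leaves add up to the sign that v would have
  as a leaf.\<close>

lemma sum_leaves_prefix:
  "v \<in> vertices T \<Longrightarrow> (\<Sum>w\<leftarrow>leaves T. if prefix v w then (- 1) ^ length w else 0) = ((- 1) ^ length v :: 3)"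
proof (induction T arbitrary: v)
  case (Caret l r)
  have *: "(\<Sum>w\<leftarrow>leaves S. if prefix u w then (- 1) ^ length (b # w) else 0)
      = - (\<Sum>w\<leftarrow>leaves S. if prefix u w then (- 1) ^ length w else (0::3))" for S u and b :: bool
    by (simp add: uminus_sum_list_map comp_def if_distrib cong: if_cong)
  show ?case
  proof (cases v)
    case Nil
    then show ?thesis using sum_leaves_sign[of "Caret l r"] by simp
  next
    case (Cons b u)
    then show ?thesis using Caret.prems Caret.IH[of u] *[of u] by (cases b) (auto simp: comp_def)
  qed
qed simp

lemma sum_nth_filter:
  fixes h :: "'a \<Rightarrow> 'b::comm_monoid_add"
  shows "(\<Sum>k | k < length ws \<and> P (ws ! k). h (ws ! k)) = (\<Sum>w\<leftarrow>ws. if P w then h w else 0)"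
proof -
  have "(\<Sum>k | k < length ws \<and> P (ws ! k). h (ws ! k)) = (\<Sum>k<length ws. if P (ws ! k) then h (ws ! k) else 0)"
    by (subst sum.inter_filter[symmetric]) auto
  then show ?thesis by (simp add: sum_list_sum_nth atLeast0LessThan)
qed

text \<open>The sum is the color difference across the edge above v. All leaves below v share its
  first digit, so the sum collapses to (-1)^|v| up to sign, which is a unit.\<close>

lemma sum_leaf_sign_separates:
  assumes "separates T p q"
  shows "(\<Sum>k\<in>{p..<q}. leaf_sign (leaves T ! k)) \<noteq> 0"
proof -
  obtain v where v: "v \<in> vertices T" "v \<noteq> []"
    "{k. k < length (leaves T) \<and> prefix v (leaves T ! k)} = {p..<q}"
    using assms by (auto simp: separates_def)
  define e :: 3 where "e = (if hd v then - 1 else 1)"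
  have sgn: "leaf_sign w = e * (- 1) ^ length w" if "prefix v w" for w
    using v(2) that by (cases v) (auto simp: leaf_sign_def e_def prefix_def minus_one_power_iff)
  have "(\<Sum>k\<in>{p..<q}. leaf_sign (leaves T ! k)) = e * (\<Sum>k\<in>{p..<q}. (- 1) ^ length (leaves T ! k))"
    unfolding v(3)[symmetric] sum_distrib_left by (rule sum.cong) (auto simp: sgn)
  also have "\<dots> = e * (- 1) ^ length v"
    unfolding v(3)[symmetric] using sum_nth_filter[where ws = "leaves T" and P = "prefix v" and h = "\<lambda>w. (- 1 :: 3) ^ length w"]
      sum_leaves_prefix[OF v(1)] by simp
  also have "\<dots> \<noteq> 0" by (simp add: e_def minus_one_power_iff)
  finally show ?thesis .
qed

text \<open>Each half of the tree sums to 1 up to sign, and the first digit makes the two signs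
  opposite. Hence partial sums give both indices of the outer region the same color.\<close>

lemma sum_leaf_sign:
  assumes "T \<noteq> Tip"
  shows "(\<Sum>k<length (leaves T). leaf_sign (leaves T ! k)) = 0"
proof -
  obtain l r where T: "T = Caret l r" using assms by (cases T) auto
  have "leaf_sign (False # w) = - (leaf_sign (True # w))" for w by (simp add: leaf_sign_def)
  moreover have "leaf_sign (True # w) = (- 1) ^ length w" for w
    by (simp add: leaf_sign_def minus_one_power_iff)
  ultimately have "(\<Sum>w\<leftarrow>leaves T. leaf_sign w) = 0"
    using sum_leaves_sign[of l] sum_leaves_sign[of r] by (simp add: T comp_def uminus_sum_list_map[unfolded comp_def, symmetric])
  then show ?thesis by (simp add: sum_list_sum_nth atLeast0LessThan)
qed

text \<open>Partial sums of the leaf signs form the coloring; since the signs agree leaf by leaf,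
  one function serves both trees.\<close>

lemma three_colorableI:
  assumes "length (leaves T) = length (leaves U)"
    and "\<And>k. k < length (leaves T) \<Longrightarrow> leaf_sign (leaves T ! k) = leaf_sign (leaves U ! k)"
  shows "three_colorable T U"
proof -
  let ?n = "length (leaves T)"
  define c :: "nat \<Rightarrow> 3" where "c k = (\<Sum>i<k. leaf_sign (leaves T ! i))" for k
  have c0n: "c 0 = c ?n" if "T \<noteq> Tip" using sum_leaf_sign[OF that] by (simp add: c_def)
  have diff: "c q - c p = (\<Sum>k\<in>{p..<q}. leaf_sign (leaves T ! k))" if "p < q" for p q
    unfolding c_def using that by (simp add: sum_diff_nat_ivl atLeast0LessThan[symmetric])
  have "c p \<noteq> c q" if "separates T p q" for p q
  proof -
    have "p < q" using that by (simp add: separates_def)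
    then show ?thesis using sum_leaf_sign_separates[OF that] unfolding diff[OF \<open>p < q\<close>, symmetric] by simp
  qed
  moreover have "c p \<noteq> c q" if "separates U p q" for p q
  proof -
    have pq: "p < q" "{p..<q} \<subseteq> {..<?n}" using that assms(1) by (auto simp: separates_def)
    have "c q - c p = (\<Sum>k\<in>{p..<q}. leaf_sign (leaves U ! k))"
      unfolding diff[OF pq(1)] by (rule sum.cong) (use pq(2) assms(2) in auto)
    then show ?thesis using sum_leaf_sign_separates[OF that] by (metis diff_self)
  qed
  ultimately have sep: "c p \<noteq> c q" if "separates T p q \<or> separates U p q" for p q
    using that by blast
  show ?thesis
  proof (cases "T = Tip")
    \<comment> \<open>The only vertex is the root, so no edge separates two regions and a constant
      coloring works.\<close>
    case True
    then have "U = Tip" using assms(1) length_leaves_eq_1 by simp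
    then show ?thesis using True by (auto simp: three_colorable_def separates_def)
  next
    case False
    then show ?thesis using c0n sep unfolding three_colorable_def by (intro exI[of _ c]) auto
  qed
qed

text \<open>The nonzero residues modulo 3 are 1 and -1. Two of them with nonzero sum are equal, and
  then a + a = -a. Here a and b are the color jumps across the edges to the two children of a
  caret.\<close>

lemma three_differences:
  fixes a b :: 3
  assumes "a \<noteq> 0" "b \<noteq> 0" "a + b \<noteq> 0"
  shows "a = - (a + b)" "b = - (a + b)"
proof -
  have "\<forall>a b :: 3. a \<noteq> 0 \<and> b \<noteq> 0 \<and> a + b \<noteq> 0 \<longrightarrow> a = - (a + b) \<and> b = - (a + b)"
    by (simp add: forall_3)
  then show "a = - (a + b)" "b = - (a + b)" using assms by blast+
qed

section \<open>Edges of a caret and of its two subtrees\<close>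

lemma nth_leaves_Caret:
  "k < length (leaves l) + length (leaves r) \<Longrightarrow> leaves (Caret l r) ! k =
    (if k < length (leaves l) then False # leaves l ! k else True # leaves r ! (k - length (leaves l)))"
  by (simp add: nth_append)

lemma separates_Caret_left:
  assumes "separates l p q" shows "separates (Caret l r) p q"
proof -
  obtain v where v: "v \<in> vertices l" "p < q" and
    *: "{k. k < length (leaves l) \<and> prefix v (leaves l ! k)} = {p..<q}"
    using assms by (auto simp: separates_def)
  have "{k. k < length (leaves l) + length (leaves r) \<and> prefix (False # v) (leaves (Caret l r) ! k)} = {p..<q}"
    unfolding *[symmetric] by (auto simp: nth_leaves_Caret simp del: leaves.simps(2) split: if_splits)
  then show ?thesis using v unfolding separates_def by (intro conjI bexI[of _ "False # v"]) auto
qed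

lemma separates_Caret_right:
  assumes "separates r p q"
  shows "separates (Caret l r) (p + length (leaves l)) (q + length (leaves l))"
proof -
  obtain v where v: "v \<in> vertices r" "p < q" and
    *: "{k. k < length (leaves r) \<and> prefix v (leaves r ! k)} = {p..<q}"
    using assms by (auto simp: separates_def)
  have "{k. k < length (leaves l) + length (leaves r) \<and> prefix (True # v) (leaves (Caret l r) ! k)}
      = (\<lambda>k. k + length (leaves l)) ` {p..<q}"
  proof (rule subset_antisym; rule subsetI, goal_cases)
    case (1 k)
    then have k: "k < length (leaves l) + length (leaves r)" "\<not> k < length (leaves l)"
      "prefix v (leaves r ! (k - length (leaves l)))"
      by (auto simp: nth_leaves_Caret simp del: leaves.simps(2) split: if_splits)
    then have "k - length (leaves l) \<in> {p..<q}" unfolding *[symmetric] by auto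
    then show ?case
      using k(2) by (intro image_eqI[of _ _ "k - length (leaves l)"]) auto
  qed (auto simp: nth_leaves_Caret *[symmetric] simp del: leaves.simps(2))
  then show ?thesis using v unfolding separates_def by (intro conjI bexI[of _ "True # v"]) auto
qed

lemma Nil_in_vertices: "[] \<in> vertices T"
  by (cases T) auto

lemma separates_Caret_children:
  shows "separates (Caret l r) 0 (length (leaves l))"
    and "separates (Caret l r) (length (leaves l)) (length (leaves l) + length (leaves r))"
proof -
  have "{k. k < length (leaves l) + length (leaves r) \<and> prefix [False] (leaves (Caret l r) ! k)} = {0..<length (leaves l)}"
    by (auto simp: nth_leaves_Caret simp del: leaves.simps(2) split: if_splits)
  then show "separates (Caret l r) 0 (length (leaves l))"
    unfolding separates_def using Nil_in_vertices length_leaves_pos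
    by (intro conjI bexI[of _ "[False]"]) auto
  have "{k. k < length (leaves l) + length (leaves r) \<and> prefix [True] (leaves (Caret l r) ! k)}
    = {length (leaves l)..<length (leaves l) + length (leaves r)}"
    by (auto simp: nth_leaves_Caret simp del: leaves.simps(2) split: if_splits)
  then show "separates (Caret l r) (length (leaves l)) (length (leaves l) + length (leaves r))"
    unfolding separates_def using Nil_in_vertices length_leaves_pos
    by (intro conjI bexI[of _ "[True]"]) auto
qed

text \<open>The third edge of a caret has the color difference opposite to the two others.\<close>

lemma coloring_leaf_difference:
  fixes c :: "nat \<Rightarrow> 3"
  assumes "\<And>p q. separates T p q \<Longrightarrow> c (p + m) \<noteq> c (q + m)"
    and "c m \<noteq> c (m + length (leaves T))" and "k < length (leaves T)"
  shows "c (Suc (m + k)) - c (m + k) = (c (m + length (leaves T)) - c m) * (- 1) ^ length (leaves T ! k)"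
  using assms
proof (induction T arbitrary: m k)
  case (Caret l r)
  let ?a = "length (leaves l)" and ?b = "length (leaves r)"
  have l: "c m \<noteq> c (m + ?a)"
    using Caret.prems(1)[OF separates_Caret_children(1)] by (simp add: add.commute)
  have r: "c (m + ?a) \<noteq> c (m + ?a + ?b)"
    using Caret.prems(1)[OF separates_Caret_children(2)] by (simp add: ac_simps)
  have "(c (m + ?a) - c m) + (c (m + ?a + ?b) - c (m + ?a)) = c (m + ?a + ?b) - c m" by simp
  then have d: "c (m + ?a) - c m = - (c (m + ?a + ?b) - c m)"
    "c (m + ?a + ?b) - c (m + ?a) = - (c (m + ?a + ?b) - c m)"
    using three_differences[of "c (m + ?a) - c m" "c (m + ?a + ?b) - c (m + ?a)"] l r Caret.prems(2)
    by (auto simp: add.assoc)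
  show ?case
  proof (cases "k < ?a")
    case True
    have "c (Suc (m + k)) - c (m + k) = (c (m + ?a) - c m) * (- 1) ^ length (leaves l ! k)"
      using Caret.prems(1)[OF separates_Caret_left] l True by (intro Caret.IH(1))
    also have "\<dots> = (c (m + ?a + ?b) - c m) * (- 1) ^ length (leaves (Caret l r) ! k)"
      unfolding d(1) using True by (simp add: nth_append del: minus_diff_eq)
    finally show ?thesis by (simp add: add.assoc)
  next
    case False
    define j where "j = k - ?a"
    have k: "k = ?a + j" using False by (simp add: j_def)
    have j: "j < ?b" using Caret.prems(3) k by simp
    \<comment> \<open>The leaves of \<open>r\<close> are numbered from \<open>?a\<close> on; the
      shift \<open>m\<close> in the statement is there to absorb this.\<close>
    have "c (Suc ((m + ?a) + j)) - c ((m + ?a) + j) = (c ((m + ?a) + ?b) - c (m + ?a)) * (- 1) ^ length (leaves r ! j)"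
    proof (rule Caret.IH(2))
      show "c (p + (m + ?a)) \<noteq> c (q + (m + ?a))" if "separates r p q" for p q
        using Caret.prems(1)[OF separates_Caret_right[OF that]] by (simp add: ac_simps)
    qed (use r j in auto)
    also have "\<dots> = (c (m + ?a + ?b) - c m) * (- 1) ^ length (leaves (Caret l r) ! k)"
      unfolding d(2) k using j by (simp add: nth_append del: minus_diff_eq)
    finally show ?thesis by (simp add: add.assoc k)
  qed
qed simp

text \<open>At the root the two outer regions coincide, so the difference changes sign with the first digit.\<close>

lemma coloring_leaf_sign:
  fixes c :: "nat \<Rightarrow> 3"
  assumes "T \<noteq> Tip" and "c 0 = c (length (leaves T))"
    and "\<And>p q. separates T p q \<Longrightarrow> c p \<noteq> c q"
  shows "\<exists>e. e \<noteq> 0 \<and> (\<forall>k<length (leaves T). c (Suc k) - c k = e * leaf_sign (leaves T ! k))"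
proof -
  obtain l r where T: "T = Caret l r" using assms(1) by (cases T) auto
  let ?a = "length (leaves l)" and ?b = "length (leaves r)"
  have l: "c 0 \<noteq> c ?a" using assms(3) separates_Caret_children(1) unfolding T by blast
  have n: "c (?a + ?b) = c 0" using assms(2) by (simp add: T)
  \<comment> \<open>The common factor is the jump across the right half, which returns to the outer
    color by \<open>n\<close>. The left half jumps by its negative, and the first digit in
    \<open>leaf_sign\<close> compensates.\<close>
  have "c (Suc k) - c k = (c 0 - c ?a) * leaf_sign (leaves T ! k)" if k: "k < length (leaves T)" for k
  proof (cases "k < ?a")
    case True
    have "c (Suc (0 + k)) - c (0 + k) = (c (0 + ?a) - c 0) * (- 1) ^ length (leaves l ! k)"
      using assms(3) separates_Caret_left l True unfolding T
      by (intro coloring_leaf_difference) auto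
    then show ?thesis using True by (simp add: T nth_append leaf_sign_def minus_one_power_iff)
  next
    case False
    define j where "j = k - ?a"
    have kj: "k = ?a + j" using False by (simp add: j_def)
    have j: "j < ?b" using k by (simp add: T kj)
    have "c (Suc (?a + j)) - c (?a + j) = (c (?a + ?b) - c ?a) * (- 1) ^ length (leaves r ! j)"
    proof (rule coloring_leaf_difference)
      show "c (p + ?a) \<noteq> c (q + ?a)" if "separates r p q" for p q
        using assms(3) separates_Caret_right[OF that] unfolding T by blast
    qed (use l n j in auto)
    then show ?thesis using j by (simp add: T kj n nth_append leaf_sign_def minus_one_power_iff)
  qed
  moreover have "c 0 - c ?a \<noteq> 0" using l by simp
  ultimately show ?thesis by blast
qed

text \<open>Both trees see the same color jumps, \<open>e\<close> times the signs of
  \<open>T\<close> and \<open>e'\<close> times the signs of \<open>U\<close>. Agreement at leaf 0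
  forces \<open>e = e'\<close>, and a nonzero factor cancels modulo 3.\<close>

lemma three_colorable_leaf_sign:
  assumes "three_colorable T U" "length (leaves T) = length (leaves U)" "T \<noteq> Tip" "U \<noteq> Tip"
    and "leaf_sign (leaves T ! 0) = leaf_sign (leaves U ! 0)" "k < length (leaves T)"
  shows "leaf_sign (leaves T ! k) = leaf_sign (leaves U ! k)"
proof -
  obtain c :: "nat \<Rightarrow> 3" where c: "c 0 = c (length (leaves T))"
    "\<And>p q. separates T p q \<or> separates U p q \<Longrightarrow> c p \<noteq> c q"
    using assms(1) by (auto simp: three_colorable_def)
  have "\<exists>e. e \<noteq> 0 \<and> (\<forall>k<length (leaves T). c (Suc k) - c k = e * leaf_sign (leaves T ! k))"
    by (rule coloring_leaf_sign[OF assms(3)]) (simp_all add: c)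
  then obtain e where e: "e \<noteq> 0" "\<And>k. k < length (leaves T) \<Longrightarrow> c (Suc k) - c k = e * leaf_sign (leaves T ! k)"
    by blast
  have "\<exists>e. e \<noteq> 0 \<and> (\<forall>k<length (leaves U). c (Suc k) - c k = e * leaf_sign (leaves U ! k))"
    by (rule coloring_leaf_sign[OF assms(4)]) (simp_all add: c assms(2)[symmetric])
  then obtain e' where e': "e' \<noteq> 0" "\<And>k. k < length (leaves T) \<Longrightarrow> c (Suc k) - c k = e' * leaf_sign (leaves U ! k)"
    unfolding assms(2) by blast
  have cancel: "x = y" if "x * leaf_sign w = y * leaf_sign w" for x y w
    using that by (auto simp: leaf_sign_def split: if_splits)
  have "e = e'"
    using e(2)[of 0] e'(2)[of 0] assms(5) length_leaves_pos[of T] by (metis cancel)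
  then have "e * leaf_sign (leaves T ! k) = e * leaf_sign (leaves U ! k)"
    using e(2)[OF assms(6)] e'(2)[OF assms(6)] by simp
  moreover have "x = y" if "e * x = e * y" for x y :: 3
  proof -
    have "e = 1 \<or> e = 2" using exhaust_3[of e] e(1) by auto
    moreover have "\<forall>x y :: 3. 2 * x = 2 * y \<longrightarrow> x = y" by (simp add: forall_3)
    ultimately show ?thesis using that by auto
  qed
  ultimately show ?thesis by blast
qed

section \<open>Elements of Thompson's group\<close>

text \<open>A signed version of \<open>dyadics\<close>: differences have to be formed, and the
  intercept of an affine piece may be negative.\<close>

definition dyadic_rationals :: "real set" where
  "dyadic_rationals = {x. \<exists>n. x * 2 ^ n \<in> \<int>}"

lemma dyadics_iff_dyadic_rationals: "x \<in> dyadics \<longleftrightarrow> 0 \<le> x \<and> x \<in> dyadic_rationals" for x :: real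
proof
  assume "x \<in> dyadics"
  then obtain m k where "x = of_nat m / 2 ^ k" by (auto simp: dyadics_def)
  then show "0 \<le> x \<and> x \<in> dyadic_rationals"
    by (auto simp: dyadic_rationals_def intro!: exI[of _ k])
next
  assume x: "0 \<le> x \<and> x \<in> dyadic_rationals"
  then obtain n z where "x * 2 ^ n = of_int z" by (auto simp: dyadic_rationals_def elim!: Ints_cases)
  then have "x = of_int z / 2 ^ n" by (simp add: field_simps)
  moreover have "0 \<le> x * 2 ^ n" using x by simp
  then have "0 \<le> z" unfolding \<open>x * 2 ^ n = of_int z\<close> by simp
  ultimately have "x = of_nat (nat z) / 2 ^ n" by simp
  then show "x \<in> dyadics" unfolding dyadics_def by blast
qed

lemma dyadic_rationals_of_int: "of_int z \<in> dyadic_rationals"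
  by (auto simp: dyadic_rationals_def intro!: exI[of _ 0])

lemma dyadic_rationals_of_nat: "of_nat n \<in> dyadic_rationals"
  using dyadic_rationals_of_int[of "int n"] by simp

lemma Ints_times_power2_mono:
  assumes "x * 2 ^ n \<in> \<int>" "n \<le> m" shows "x * 2 ^ m \<in> (\<int> :: real set)"
proof -
  have "(2::real) ^ m = 2 ^ n * 2 ^ (m - n)" using assms(2) by (metis le_add_diff_inverse power_add)
  then have "x * 2 ^ m = x * 2 ^ n * 2 ^ (m - n)" by (simp only: mult.assoc)
  also have "\<dots> \<in> \<int>" by (intro Ints_mult[OF assms(1)] Ints_power) simp
  finally show ?thesis .
qed

lemma dyadic_rationals_add:
  assumes "x \<in> dyadic_rationals" "y \<in> dyadic_rationals" shows "x + y \<in> dyadic_rationals"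
proof -
  obtain m n where "x * 2 ^ m \<in> \<int>" "y * 2 ^ n \<in> \<int>" using assms by (auto simp: dyadic_rationals_def)
  then have "(x + y) * 2 ^ (max m n) \<in> \<int>"
    unfolding distrib_right by (intro Ints_add) (auto elim: Ints_times_power2_mono)
  then show ?thesis by (auto simp: dyadic_rationals_def)
qed

lemma dyadic_rationals_minus: "x \<in> dyadic_rationals \<Longrightarrow> - x \<in> dyadic_rationals"
  by (auto simp: dyadic_rationals_def)

lemma dyadic_rationals_diff: "x \<in> dyadic_rationals \<Longrightarrow> y \<in> dyadic_rationals \<Longrightarrow> x - y \<in> dyadic_rationals"
  using dyadic_rationals_add[of x "- y"] dyadic_rationals_minus by simp

lemma dyadic_rationals_divide_power:
  assumes "x \<in> dyadic_rationals" shows "x / 2 ^ m \<in> dyadic_rationals"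
proof -
  obtain n where "x * 2 ^ n \<in> \<int>" using assms by (auto simp: dyadic_rationals_def)
  moreover have "x / 2 ^ m * 2 ^ (m + n) = x * 2 ^ n" by (simp add: power_add)
  ultimately have "x / 2 ^ m * 2 ^ (m + n) \<in> \<int>" by (simp only:)
  then show ?thesis unfolding dyadic_rationals_def by blast
qed

lemma dyadic_rationals_times_powi:
  assumes "x \<in> dyadic_rationals" shows "2 powi k * x \<in> dyadic_rationals"
proof (cases "k \<ge> 0")
  case True
  obtain n where "x * 2 ^ n \<in> \<int>" using assms by (auto simp: dyadic_rationals_def)
  then have "2 ^ nat k * (x * 2 ^ n) \<in> \<int>" by (rule Ints_mult[OF Ints_power[OF Ints_numeral]])
  then show ?thesis using True by (auto simp: dyadic_rationals_def power_int_def mult.assoc)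
next
  case False
  define n where "n = nat (- k)"
  have "k = - int n" using False by (simp add: n_def)
  then have "2 powi k * x = x / 2 ^ n" by (simp add: power_int_minus field_simps)
  then show ?thesis using dyadic_rationals_divide_power[OF assms, of n] by simp
qed

lemma finite_dyadic_common_denominator:
  assumes "finite B" "B \<subseteq> dyadic_rationals"
  shows "\<exists>n. \<forall>b\<in>B. b * 2 ^ n \<in> \<int>"
  using assms
proof (induction B)
  case (insert b B)
  then obtain n m where "\<forall>b\<in>B. b * 2 ^ n \<in> \<int>" "b * 2 ^ m \<in> \<int>" by (auto simp: dyadic_rationals_def)
  then have "c * 2 ^ max n m \<in> \<int>" if "c \<in> insert b B" for c
    using that Ints_times_power2_mono[of c n "max n m"] Ints_times_power2_mono[of c m "max n m"] by auto
  then show ?case by blast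
qed simp

section \<open>Maps that are affine off a finite set\<close>

lemma ex_gap_right:
  fixes t :: real
  assumes "finite B" "t < u" shows "\<exists>e. t < e \<and> e \<le> u \<and> {t<..<e} \<inter> B = {}"
proof -
  let ?e = "Min (insert u (B \<inter> {t<..}))"
  have fin: "finite (insert u (B \<inter> {t<..}))" using assms(1) by simp
  have "t < ?e" using fin assms(2) by (subst Min_gr_iff) auto
  moreover have "?e \<le> u" using fin by (intro Min_le) auto
  moreover have "?e \<le> b" if "b \<in> B" "t < b" for b using fin that by (intro Min_le) auto
  ultimately show ?thesis by (intro exI[of _ ?e]) fastforce
qed

lemma ex_gap_left:
  fixes t :: real
  assumes "finite B" "u < t" shows "\<exists>e. u \<le> e \<and> e < t \<and> {e<..<t} \<inter> B = {}"
proof -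
  let ?e = "Max (insert u (B \<inter> {..<t}))"
  have fin: "finite (insert u (B \<inter> {..<t}))" using assms(1) by simp
  have "?e < t" using fin assms(2) by (subst Max_less_iff) auto
  moreover have "u \<le> ?e" using fin by (intro Max_ge) auto
  moreover have "b \<le> ?e" if "b \<in> B" "b < t" for b using fin that by (intro Max_ge) auto
  ultimately show ?thesis by (intro exI[of _ ?e]) fastforce
qed

text \<open>The affinity clause of \<open>thompson_elements\<close> with the break set as a
  parameter, so that the set can be enlarged or transported by a map. The formula is required on
  closed intervals, so adjacent pieces agree at break points.\<close>

definition affine_off :: "real set \<Rightarrow> (real \<Rightarrow> real) \<Rightarrow> bool" where
  "affine_off B f \<longleftrightarrow> (\<forall>a b. 0 \<le> a \<and> a < b \<and> b \<le> 1 \<and> {a<..<b} \<inter> B = {} \<longrightarrow>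
    (\<exists>(k::int) d. \<forall>t\<in>{a..b}. f t = 2 powi k * t + d))"

text \<open>The difference form trades the intercept for a base point that can be chosen anywhere in
  the interval.\<close>

lemma affine_offD:
  assumes "affine_off B f" "0 \<le> a" "a < b" "b \<le> 1" "{a<..<b} \<inter> B = {}"
  obtains k :: int where "\<And>s t. s \<in> {a..b} \<Longrightarrow> t \<in> {a..b} \<Longrightarrow> f t = f s + 2 powi k * (t - s)"
proof -
  obtain k d where "\<forall>t\<in>{a..b}. f t = 2 powi k * t + d"
    using assms unfolding affine_off_def by blast
  then have "f t = f s + 2 powi k * (t - s)" if "s \<in> {a..b}" "t \<in> {a..b}" for s t
    using that by (simp add: algebra_simps)
  then show ?thesis using that by blast
qed

lemma affine_offI:
  assumes "\<And>a b. 0 \<le> a \<Longrightarrow> a < b \<Longrightarrow> b \<le> 1 \<Longrightarrow> {a<..<b} \<inter> B = {} \<Longrightarrow>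
    \<exists>k::int. \<forall>t\<in>{a..b}. f t = f a + 2 powi k * (t - a)"
  shows "affine_off B f"
  unfolding affine_off_def
proof (intro allI impI)
  fix a b assume "0 \<le> a \<and> a < b \<and> b \<le> 1 \<and> {a<..<b} \<inter> B = {}"
  then obtain k :: int where "\<forall>t\<in>{a..b}. f t = f a + 2 powi k * (t - a)" using assms by blast
  then have "\<forall>t\<in>{a..b}. f t = 2 powi k * t + (f a - 2 powi k * a)" by (simp add: algebra_simps)
  then show "\<exists>(k::int) d. \<forall>t\<in>{a..b}. f t = 2 powi k * t + d" by blast
qed

section \<open>Order, endpoints and dyadic points under elements of F\<close>

lemma thompson_elements_iff:
  "f \<in> thompson_elements \<longleftrightarrow> (\<forall>t. t \<notin> {0..1} \<longrightarrow> f t = t) \<and> (\<exists>g. homeomorphism {0..1} {0..1} f g) \<and>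
    (\<exists>B. finite B \<and> B \<subseteq> dyadics \<inter> {0..1} \<and> affine_off B f)"
  by (simp add: thompson_elements_def affine_off_def)

text \<open>A continuous injective map on an interval is strictly monotone, and the positive slope
  of the first affine piece rules out a decreasing one.\<close>

lemma thompson_strict_mono:
  assumes "f \<in> thompson_elements"
  shows "strict_mono_on {0..1} f"
proof -
  obtain g B where g: "homeomorphism {0..1} {0..1} f g" and B: "finite B" "affine_off B f"
    using assms by (auto simp: thompson_elements_iff)
  have "inj_on f {0..1}" using homeomorphism_apply1[OF g] by (metis inj_on_inverseI)
  then have "strict_mono_on {0..1} f \<or> monotone_on {0..1} (<) (>) f"
    using homeomorphism_cont1[OF g] injective_eq_monotone_map[of "{0..1}" f] by (simp add: is_interval_cc)
  moreover have "\<not> monotone_on {0..1} (<) (>) f"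
  proof
    assume anti: "monotone_on {0..1} (<) (>) f"
    obtain e where e: "0 < e" "e \<le> 1" "{0<..<e} \<inter> B = {}"
      using ex_gap_right[OF B(1), of 0 1] by auto
    then obtain k :: int where "f e = f 0 + 2 powi k * (e - 0)"
      using affine_offD[OF B(2), of 0 e] by (metis atLeastAtMost_iff less_eq_real_def order_refl)
    then have "f 0 < f e" using e(1) by simp
    moreover have "f e < f 0" using monotone_onD[OF anti, of 0 e] e by simp
    ultimately show False by simp
  qed
  ultimately show ?thesis by blast
qed

lemma thompson_image:
  assumes "f \<in> thompson_elements" shows "f ` {0..1} = {0..1}"
  using assms homeomorphism_image1 unfolding thompson_elements_iff by blast

lemma thompson_mono:
  assumes "f \<in> thompson_elements" "s \<in> {0..1}" "t \<in> {0..1}"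
  shows "f s < f t \<longleftrightarrow> s < t" "f s \<le> f t \<longleftrightarrow> s \<le> t"
  using thompson_strict_mono[OF assms(1)] assms(2,3)
  by (auto simp: strict_mono_on_less strict_mono_on_less_eq)

lemma thompson_range:
  assumes "f \<in> thompson_elements" "t \<in> {0..1}" shows "f t \<in> {0..1}"
  using thompson_image[OF assms(1)] assms(2) by blast

lemma thompson_endpoints:
  assumes "f \<in> thompson_elements" shows "f 0 = 0" "f 1 = 1"
proof -
  have "0 \<in> f ` {0..1}" "1 \<in> f ` {0..1}" unfolding thompson_image[OF assms] by simp_all
  then obtain s t where "s \<in> {0..1}" "f s = 0" "t \<in> {0..1}" "f t = 1" by (metis imageE)
  moreover have "f 0 \<in> {0..1}" "f 1 \<in> {0..1}" using thompson_range[OF assms] by auto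
  ultimately show "f 0 = 0" "f 1 = 1"
    using thompson_mono(2)[OF assms, of 0 s] thompson_mono(2)[OF assms, of t 1] by auto
qed

lemma thompson_less_1:
  assumes "f \<in> thompson_elements" "t \<in> {0..<1}" shows "f t \<in> {0..<1}"
  using thompson_range[OF assms(1), of t] thompson_mono(1)[OF assms(1), of t 1]
    thompson_endpoints[OF assms(1)] assms(2) by auto

text \<open>With 2^n a common denominator of the break points, each of them is a grid point, so the
  open cells contain none.\<close>

lemma thompson_grid:
  assumes "f \<in> thompson_elements"
  shows "\<exists>n. \<forall>j<2^n. \<exists>k::int. \<forall>s\<in>{real j / 2 ^ n..real (Suc j) / 2 ^ n}. \<forall>t\<in>{real j / 2 ^ n..real (Suc j) / 2 ^ n}.
    f t = f s + 2 powi k * (t - s)"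
proof -
  obtain B where B: "finite B" "affine_off B f" "B \<subseteq> dyadics"
    using assms by (auto simp: thompson_elements_iff)
  have "B \<subseteq> dyadic_rationals" using B(3) dyadics_iff_dyadic_rationals by auto
  then obtain n where n: "\<forall>b\<in>B. b * 2 ^ n \<in> \<int>"
    using finite_dyadic_common_denominator B(1) by blast
  have "\<exists>k::int. \<forall>s\<in>{real j / 2 ^ n..real (Suc j) / 2 ^ n}. \<forall>t\<in>{real j / 2 ^ n..real (Suc j) / 2 ^ n}.
      f t = f s + 2 powi k * (t - s)" if j: "j < 2 ^ n" for j
  proof -
    have "real (Suc j) \<le> 2 ^ n" using j by (metis Suc_leI of_nat_le_iff of_nat_numeral of_nat_power)
    then have 1: "real (Suc j) / 2 ^ n \<le> 1" by simp
    have 2: "real j / 2 ^ n < real (Suc j) / 2 ^ n" by (simp add: divide_strict_right_mono)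
    \<comment> \<open>Such a point, multiplied by 2^n, would be an integer strictly between j and j
      + 1.\<close>
    have "False" if "b \<in> B" "real j / 2 ^ n < b" "b < real (Suc j) / 2 ^ n" for b
    proof -
      have "b * 2 ^ n \<in> \<int>" using n that(1) by blast
      then obtain z :: int where z: "b * 2 ^ n = of_int z" by (rule Ints_cases)
      have "real j < of_int z" "of_int z < real (Suc j)"
        using that(2,3) unfolding z[symmetric] by (auto simp: field_simps)
      then have "int j < z" "z < int j + 1" by linarith+
      then show False by linarith
    qed
    then have 3: "{real j / 2 ^ n<..<real (Suc j) / 2 ^ n} \<inter> B = {}" by auto
    show ?thesis using affine_offD[OF B(2) _ 2 1 3] by (metis divide_nonneg_nonneg of_nat_0_le_iff zero_le_numeral zero_le_power)
  qed
  then show ?thesis by blast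
qed

lemma ex_grid_interval:
  assumes "t \<in> {0..<1}"
  shows "\<exists>j<2^n. t \<in> {real j / 2 ^ n..real (Suc j) / 2 ^ n}"
proof -
  define j where "j = nat \<lfloor>t * 2 ^ n\<rfloor>"
  have j: "real j \<le> t * 2 ^ n" "t * 2 ^ n < real j + 1"
    using assms by (auto simp: j_def)
  have "t * 2 ^ n < 2 ^ n" using assms by simp
  then have "real j < 2 ^ n" using j by linarith
  then have "j < 2 ^ n" by (metis of_nat_less_iff of_nat_numeral of_nat_power)
  then show ?thesis using j by (intro exI[of _ j]) (auto simp: field_simps)
qed

text \<open>Values at grid points are dyadic by induction from f 0 = 0, each step adding a power of
  2 times a dyadic number; a dyadic point inside a cell is reached from the left end in the same
  way.\<close>

lemma thompson_dyadic:
  assumes "f \<in> thompson_elements" "t \<in> {0..1}" "t \<in> dyadic_rationals"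
  shows "f t \<in> dyadic_rationals"
proof (cases "t = 1")
  case True
  then show ?thesis using thompson_endpoints[OF assms(1)] dyadic_rationals_of_int[of 1] by simp
next
  case False
  obtain n where n: "\<And>j. j < 2 ^ n \<Longrightarrow> \<exists>k::int. \<forall>s\<in>{real j / 2 ^ n..real (Suc j) / 2 ^ n}. \<forall>t\<in>{real j / 2 ^ n..real (Suc j) / 2 ^ n}.
    f t = f s + 2 powi k * (t - s)" using thompson_grid[OF assms(1)] by blast
  have le: "real j / 2 ^ n \<le> real (Suc j) / 2 ^ n" for j by (simp add: divide_right_mono)
  have dy: "real j / 2 ^ n \<in> dyadic_rationals" for j
    by (intro dyadic_rationals_divide_power dyadic_rationals_of_nat)
  have grid: "j \<le> 2 ^ n \<Longrightarrow> f (real j / 2 ^ n) \<in> dyadic_rationals" for j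
  proof (induction j)
    case 0
    then show ?case using thompson_endpoints[OF assms(1)] dyadic_rationals_of_int[of 0] by simp
  next
    case (Suc j)
    then obtain k :: int where "f (real (Suc j) / 2 ^ n) = f (real j / 2 ^ n) + 2 powi k * (real (Suc j) / 2 ^ n - real j / 2 ^ n)"
      using n[of j] le[of j] by (metis Suc_le_lessD atLeastAtMost_iff order_refl)
    moreover have "\<dots> \<in> dyadic_rationals"
      using Suc dy[of j] dy[of "Suc j"]
      by (intro dyadic_rationals_add dyadic_rationals_times_powi dyadic_rationals_diff) (auto simp del: of_nat_Suc)
    ultimately show ?case by simp
  qed
  have "t \<in> {0..<1}" using False assms(2) by auto
  then obtain j where j: "j < 2 ^ n" "t \<in> {real j / 2 ^ n..real (Suc j) / 2 ^ n}"
    using ex_grid_interval by blast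
  then obtain k :: int where "f t = f (real j / 2 ^ n) + 2 powi k * (t - real j / 2 ^ n)"
    using n[of j] le[of j] by (metis atLeastAtMost_iff order_refl)
  then show ?thesis using grid[of j] j(1) dy assms(3)
    by (auto intro!: dyadic_rationals_add dyadic_rationals_times_powi dyadic_rationals_diff)
qed

lemma thompson_dyadics:
  assumes "f \<in> thompson_elements" "t \<in> dyadics \<inter> {0..1}" shows "f t \<in> dyadics \<inter> {0..1}"
  using thompson_dyadic[OF assms(1), of t] thompson_range[OF assms(1), of t] assms(2)
  by (auto simp: dyadics_iff_dyadic_rationals)

section \<open>Inverses, products and gluing in F\<close>

lemma thompson_inverse:
  assumes f: "f \<in> thompson_elements"
  shows "\<exists>g\<in>thompson_elements. (\<forall>t. g (f t) = t) \<and> (\<forall>t. f (g t) = t)"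
proof -
  obtain h B where off: "\<forall>t. t \<notin> {0..1} \<longrightarrow> f t = t" and h: "homeomorphism {0..1} {0..1} f h"
    and B: "finite B" "B \<subseteq> dyadics \<inter> {0..1}" "affine_off B f"
    using f by (auto simp: thompson_elements_iff)
  \<comment> \<open>Nothing is known about \<open>h\<close> outside [0,1], where the chosen
    representative has to be the identity.\<close>
  define g where "g t = (if t \<in> {0..1} then h t else t)" for t
  have g: "homeomorphism {0..1} {0..1} f g"
    using h by (rule homeomorphism_cong) (auto simp: g_def)
  have gf: "g (f t) = t" for t
    using homeomorphism_apply1[OF h] thompson_range[OF f] off by (cases "t \<in> {0..1}") (auto simp: g_def)
  have fg: "f (g t) = t" for t
    using homeomorphism_apply2[OF h] off by (auto simp: g_def)
  have g01: "g t \<in> {0..1}" if "t \<in> {0..1}" for t using homeomorphism_image2[OF g] that by blast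
  have gless: "g s < g t" if "s \<in> {0..1}" "t \<in> {0..1}" "s < t" for s t
    using thompson_mono(1)[OF f g01 g01, OF that(1,2)] that(3) by (simp add: fg)
  \<comment> \<open>The inverse breaks at the images of the break points of \<open>f\<close>, and a
    piece of slope 2^k is inverted with slope 2^(-k).\<close>
  have "affine_off (f ` B) g"
  proof (rule affine_offI)
    fix a b :: real assume ab: "0 \<le> a" "a < b" "b \<le> 1" "{a<..<b} \<inter> f ` B = {}"
    have "{g a<..<g b} \<inter> B = {}"
    proof -
      have "False" if "y \<in> B" "g a < y" "y < g b" for y
      proof -
        have "y \<in> {0..1}" using that B(2) by auto
        then have "a < f y" "f y < b"
          using that thompson_mono(1)[OF f, of "g a" y] thompson_mono(1)[OF f, of y "g b"] g01[of a] g01[of b] ab(1-3)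
          by (auto simp: fg)
        then show False using ab(4) that(1) by auto
      qed
      then show ?thesis by auto
    qed
    then obtain k :: int where k: "\<And>s t. s \<in> {g a..g b} \<Longrightarrow> t \<in> {g a..g b} \<Longrightarrow> f t = f s + 2 powi k * (t - s)"
      using affine_offD[OF B(3), of "g a" "g b"] gless[of a b] g01[of a] g01[of b] ab(1-3) by auto
    have "g t = g a + 2 powi (- k) * (t - a)" if t: "t \<in> {a..b}" for t
    proof -
      have "g a \<le> g t" "g t \<le> g b" using gless[of a t] gless[of t b] t ab(1-3) by (cases "t = a"; cases "t = b"; auto)+
      then have "f (g t) = f (g a) + 2 powi k * (g t - g a)" by (intro k) auto
      then show ?thesis by (simp add: fg power_int_minus field_simps)
    qed
    then show "\<exists>k::int. \<forall>t\<in>{a..b}. g t = g a + 2 powi k * (t - a)" by blast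
  qed
  moreover have "f ` B \<subseteq> dyadics \<inter> {0..1}" using thompson_dyadics[OF f] B(2) by blast
  ultimately have "g \<in> thompson_elements"
    unfolding thompson_elements_iff using B(1) homeomorphism_sym[THEN iffD1, OF g]
    by (intro conjI) (auto simp: g_def)
  then show ?thesis using gf fg by blast
qed

lemma thompson_compose:
  assumes f: "f \<in> thompson_elements" and g: "g \<in> thompson_elements"
  shows "(\<lambda>t. g (f t)) \<in> thompson_elements"
proof -
  obtain f' A where f': "homeomorphism {0..1} {0..1} f f'"
    and A: "finite A" "A \<subseteq> dyadics \<inter> {0..1}" "affine_off A f"
    using f by (auto simp: thompson_elements_iff)
  obtain g' B where g': "homeomorphism {0..1} {0..1} g g'"
    and B: "finite B" "B \<subseteq> dyadics \<inter> {0..1}" "affine_off B g"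
    using g by (auto simp: thompson_elements_iff)
  obtain h where h: "h \<in> thompson_elements" "\<And>t. h (f t) = t" "\<And>t. f (h t) = t"
    using thompson_inverse[OF f] by blast
  \<comment> \<open>The composite can break where \<open>f\<close> breaks, or where \<open>f\<close>
    hits a break point of \<open>g\<close>; the latter points are found with the inverse
    \<open>h\<close> of \<open>f\<close>.\<close>
  have "affine_off (A \<union> h ` B) (\<lambda>t. g (f t))"
  proof (rule affine_offI)
    fix a b :: real assume ab: "0 \<le> a" "a < b" "b \<le> 1" "{a<..<b} \<inter> (A \<union> h ` B) = {}"
    then have "{a<..<b} \<inter> A = {}" by blast
    then obtain k :: int where k: "\<And>s t. s \<in> {a..b} \<Longrightarrow> t \<in> {a..b} \<Longrightarrow> f t = f s + 2 powi k * (t - s)"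
      using affine_offD[OF A(3) ab(1-3)] by blast
    have fa: "f a \<in> {0..1}" "f b \<in> {0..1}" "f a < f b"
      using thompson_range[OF f] thompson_mono(1)[OF f, of a b] ab(1-3) by auto
    have "False" if "y \<in> B" "f a < y" "y < f b" for y
    proof -
      have "h y \<in> {0..1}" using thompson_range[OF h(1)] B(2) that(1) by blast
      then have "a < h y" "h y < b"
        using thompson_mono(1)[OF f, of a "h y"] thompson_mono(1)[OF f, of "h y" b] that ab(1-3) by (auto simp: h)
      then show False using ab(4) that(1) by auto
    qed
    then have "{f a<..<f b} \<inter> B = {}" by auto
    then obtain l :: int where l: "\<And>s t. s \<in> {f a..f b} \<Longrightarrow> t \<in> {f a..f b} \<Longrightarrow> g t = g s + 2 powi l * (t - s)"
      using affine_offD[OF B(3), of "f a" "f b"] fa by auto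
    have "g (f t) = g (f a) + 2 powi (l + k) * (t - a)" if t: "t \<in> {a..b}" for t
    proof -
      have "f t \<in> {f a..f b}" using thompson_mono(2)[OF f] t ab(1-3) by auto
      then have "g (f t) = g (f a) + 2 powi l * (f t - f a)" using fa(3) by (intro l) auto
      also have "f t - f a = 2 powi k * (t - a)" using k[of a t] t by auto
      finally show ?thesis by (simp add: power_int_add mult.assoc)
    qed
    then show "\<exists>k::int. \<forall>t\<in>{a..b}. g (f t) = g (f a) + 2 powi k * (t - a)" by blast
  qed
  moreover have "h ` B \<subseteq> dyadics \<inter> {0..1}" using thompson_dyadics[OF h(1)] B(2) by blast
  moreover have "homeomorphism {0..1} {0..1} (\<lambda>t. g (f t)) (f' \<circ> g')"
    using homeomorphism_compose[OF f' g'] by (simp add: comp_def)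
  ultimately show ?thesis
    unfolding thompson_elements_iff using A(1,2) B(1) f g
    by (intro conjI exI[of _ "f' \<circ> g'"] exI[of _ "A \<union> h ` B"]) (auto simp: thompson_elements_iff)
qed

lemma thompson_id: "(\<lambda>t. t) \<in> thompson_elements"
proof -
  have "affine_off {} (\<lambda>t. t)"
    by (rule affine_offI) (auto intro!: exI[of _ "0::int"])
  moreover have "homeomorphism {0..1} {0..1} (\<lambda>t::real. t) (\<lambda>t. t)"
    by (auto simp: homeomorphism_def)
  ultimately show ?thesis unfolding thompson_elements_iff by blast
qed

text \<open>The intermediate value theorem gives surjectivity, and compactness makes the inverse
  continuous.\<close>

lemma thompson_elementsI:
  assumes "\<And>t. t \<notin> {0..1} \<Longrightarrow> f t = t" "continuous_on {0..1} f" "strict_mono_on {0..1} f"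
    and "f 0 = 0" "f 1 = 1" "finite B" "B \<subseteq> dyadics \<inter> {0..1}" "affine_off B f"
  shows "f \<in> thompson_elements"
proof -
  have "f ` {0..1} = {0..1}"
  proof
    show "f ` {0..1} \<subseteq> {0..1}"
      using strict_mono_on_leD[OF assms(3), of 0] strict_mono_on_leD[OF assms(3), of _ 1] assms(4,5) by fastforce
    show "{0..1} \<subseteq> f ` {0..1}"
      using IVT'[of f 0 _ 1] assms(2,4,5) by fastforce
  qed
  then have "\<exists>g. homeomorphism {0..1} {0..1} f g"
    using assms(2,3) by (intro homeomorphism_compact strict_mono_on_imp_inj_on) auto
  then show ?thesis using assms unfolding thompson_elements_iff by blast
qed

lemma thompson_continuous: "f \<in> thompson_elements \<Longrightarrow> continuous_on {0..1} f"
  using homeomorphism_cont1 unfolding thompson_elements_iff by blast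

text \<open>With \<alpha> in the break set, every admissible interval stays on one side of \<alpha>,
  where \<open>u\<close> is one of the two maps.\<close>

lemma thompson_component_cong:
  assumes "affine_off B f" "affine_off B g" "0 \<le> \<alpha>" "\<alpha> \<le> 1"
    and "\<And>t. t \<in> {0..\<alpha>} \<Longrightarrow> u t = f t" "\<And>t. t \<in> {\<alpha>..1} \<Longrightarrow> u t = g t"
  shows "affine_off (insert \<alpha> B) u"
proof (rule affine_offI)
  fix a b :: real assume ab: "0 \<le> a" "a < b" "b \<le> 1" "{a<..<b} \<inter> insert \<alpha> B = {}"
  then have "b \<le> \<alpha> \<or> \<alpha> \<le> a" by (metis Int_insert_right_if1 greaterThanLessThan_iff insert_not_empty not_le)
  then show "\<exists>k::int. \<forall>t\<in>{a..b}. u t = u a + 2 powi k * (t - a)"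
  proof
    assume side: "b \<le> \<alpha>"
    obtain k :: int where k: "\<And>s t. s \<in> {a..b} \<Longrightarrow> t \<in> {a..b} \<Longrightarrow> f t = f s + 2 powi k * (t - s)"
      using affine_offD[OF assms(1) ab(1-3)] ab(4) by blast
    have "u t = f t" if "t \<in> {a..b}" for t using that side ab(1,3) by (intro assms(5)) auto
    then have "u t = u a + 2 powi k * (t - a)" if "t \<in> {a..b}" for t
      using k[of a t] that ab(2) by simp
    then show ?thesis by blast
  next
    assume side: "\<alpha> \<le> a"
    obtain k :: int where k: "\<And>s t. s \<in> {a..b} \<Longrightarrow> t \<in> {a..b} \<Longrightarrow> g t = g s + 2 powi k * (t - s)"
      using affine_offD[OF assms(2) ab(1-3)] ab(4) by blast
    have "u t = g t" if "t \<in> {a..b}" for t using that side ab(1,3) by (intro assms(6)) auto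
    then have "u t = u a + 2 powi k * (t - a)" if "t \<in> {a..b}" for t
      using k[of a t] that ab(2) by simp
    then show ?thesis by blast
  qed
qed

lemma thompson_glue:
  assumes f: "f \<in> thompson_elements" and g: "g \<in> thompson_elements"
    and \<alpha>: "\<alpha> \<in> dyadics \<inter> {0<..<1}" "f \<alpha> = \<alpha>" "g \<alpha> = \<alpha>"
  shows "(\<lambda>t. if t \<le> \<alpha> then f t else g t) \<in> thompson_elements" (is "?u \<in> _")
proof -
  obtain A where A: "finite A" "A \<subseteq> dyadics \<inter> {0..1}" "affine_off A f"
    using f by (auto simp: thompson_elements_iff)
  obtain B where B: "finite B" "B \<subseteq> dyadics \<inter> {0..1}" "affine_off B g"
    using g by (auto simp: thompson_elements_iff)
  have "affine_off (A \<union> B) f" "affine_off (A \<union> B) g"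
    using A(3) B(3) unfolding affine_off_def Int_Un_distrib by blast+
  then have "affine_off (insert \<alpha> (A \<union> B)) ?u"
    using \<alpha> by (intro thompson_component_cong[where f = f and g = g]) auto
  moreover have "continuous_on {0..1} ?u"
  proof -
    have "continuous_on ({0..\<alpha>} \<union> {\<alpha>..1}) ?u"
      using \<alpha> thompson_continuous[OF f] thompson_continuous[OF g]
      by (intro continuous_on_cases) (auto elim: continuous_on_subset)
    moreover have "{0..\<alpha>} \<union> {\<alpha>..1} = {0..1}" using \<alpha>(1) by auto
    ultimately show ?thesis by simp
  qed
  moreover have "strict_mono_on {0..1} ?u"
  proof (rule strict_mono_onI)
    fix s t :: real assume st: "s \<in> {0..1}" "t \<in> {0..1}" "s < t"
    show "?u s < ?u t"
    \<comment> \<open>If s and t lie on different sides, the common fixed point separates the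
      values: f s \<le> \<alpha> < g t.\<close>
    proof (cases "s \<le> \<alpha> \<and> \<alpha> < t")
      case True
      then show ?thesis
        using thompson_mono(2)[OF f, of s \<alpha>] thompson_mono(1)[OF g, of \<alpha> t] st \<alpha> by auto
    next
      case False
      then show ?thesis using thompson_mono(1)[OF f st(1,2)] thompson_mono(1)[OF g st(1,2)] st(3) by auto
    qed
  qed
  ultimately show ?thesis
    using f g \<alpha> A B thompson_endpoints[OF f] thompson_endpoints[OF g]
    by (intro thompson_elementsI[where B = "insert \<alpha> (A \<union> B)"]) (auto simp: thompson_elements_iff)
qed

section \<open>Existence of a tree diagram for each element of F\<close>

lemma dyadic_image_interval:
  fixes y :: real and K :: int
  assumes "K \<le> int m" "y * 2 ^ nat (int m - K) \<in> \<int>" "y \<in> {0..<1}"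
  shows "\<exists>p q. y = real p / 2 ^ q \<and> p < 2 ^ q \<and> (2 powi K :: real) = 2 ^ m / 2 ^ q"
proof -
  \<comment> \<open>A cell of length 1/2^m is scaled by 2^K to length 1/2^q. With y * 2^q an
    integer, the image starting at y is a standard dyadic interval, hence the interval of a
    word.\<close>
  define q where "q = nat (int m - K)"
  obtain z :: int where z: "y * 2 ^ q = of_int z" using assms(2) by (auto simp: q_def elim: Ints_cases)
  have "0 \<le> y * 2 ^ q" "y * 2 ^ q < 2 ^ q" using assms(3) by auto
  then have z0: "0 \<le> z" and "real_of_int z < real_of_int (2 ^ q)" unfolding z by simp_all
  then have "z < 2 ^ q" unfolding of_int_less_iff by simp
  then have "nat z < 2 ^ q" using z0 by (simp add: nat_less_iff)
  moreover have "y = real (nat z) / 2 ^ q" using z z0 by (simp add: field_simps)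
  moreover have "2 powi K = (2 powi (int m - int q) :: real)" using assms(1) by (simp add: q_def)
  then have "2 powi K = (2 ^ m / 2 ^ q :: real)" by (simp add: power_int_diff)
  ultimately show ?thesis by blast
qed

text \<open>A grid of affinity is refined until each cell maps onto a standard dyadic interval. On a
  piece 2^k * t + d the point i/2^m goes to a multiple of 1/2^(m-k) as soon as 2^(m-k) clears the
  denominator of d.\<close>

lemma thompson_subdivision:
  assumes f: "f \<in> thompson_elements"
  shows "\<exists>m. \<forall>i<2^m. \<exists>p q. f (real i / 2 ^ m) = real p / 2 ^ q \<and> p < 2 ^ q \<and>
    (\<forall>t\<in>{real i / 2 ^ m..real (Suc i) / 2 ^ m}. f t = f (real i / 2 ^ m) + 2 ^ m / 2 ^ q * (t - real i / 2 ^ m))"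
proof -
  obtain n where n: "\<And>j. j < 2 ^ n \<Longrightarrow> \<exists>k::int. \<forall>s\<in>{real j / 2 ^ n..real (Suc j) / 2 ^ n}. \<forall>t\<in>{real j / 2 ^ n..real (Suc j) / 2 ^ n}.
    f t = f s + 2 powi k * (t - s)" using thompson_grid[OF f] by blast
  then obtain k :: "nat \<Rightarrow> int" where k: "\<And>j s t. j < 2 ^ n \<Longrightarrow> s \<in> {real j / 2 ^ n..real (Suc j) / 2 ^ n} \<Longrightarrow>
    t \<in> {real j / 2 ^ n..real (Suc j) / 2 ^ n} \<Longrightarrow> f t = f s + 2 powi k j * (t - s)" by metis
  define d where "d j = f (real j / 2 ^ n) - 2 powi k j * (real j / 2 ^ n)" for j
  have "d j \<in> dyadic_rationals" if "j < 2 ^ n" for j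
  proof -
    have "real j \<le> 2 ^ n" using that by (metis less_imp_le of_nat_le_iff of_nat_numeral of_nat_power)
    then show ?thesis unfolding d_def
      by (intro dyadic_rationals_diff thompson_dyadic[OF f] dyadic_rationals_times_powi
          dyadic_rationals_divide_power dyadic_rationals_of_nat) auto
  qed
  then obtain r where r: "\<And>j. j < 2 ^ n \<Longrightarrow> d j * 2 ^ r j \<in> \<int>" unfolding dyadic_rationals_def by (simp, metis)
  \<comment> \<open>A crude bound for all pieces at once, giving k j + r j \<le> m. The truncation
    by \<open>nat\<close> keeps negative exponents from lowering the sum.\<close>
  define e where "e = (\<Sum>j<2^n. r j + nat (k j))"
  define m where "m = n + e"
  have "\<exists>p q. f (real i / 2 ^ m) = real p / 2 ^ q \<and> p < 2 ^ q \<and>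
    (\<forall>t\<in>{real i / 2 ^ m..real (Suc i) / 2 ^ m}. f t = f (real i / 2 ^ m) + 2 ^ m / 2 ^ q * (t - real i / 2 ^ m))"
    if i: "i < 2 ^ m" for i
  proof -
    \<comment> \<open>The coarse cell that contains the i-th fine one.\<close>
    define j where "j = i div 2 ^ e"
    have j: "j < 2 ^ n" using i by (simp add: j_def m_def power_add less_mult_imp_div_less)
    have "j * 2 ^ e \<le> i" "Suc i \<le> Suc j * 2 ^ e"
      using dividend_less_times_div[of "2 ^ e" i] by (simp_all add: j_def Suc_le_eq mult.commute)
    then have "real j * 2 ^ e \<le> real i" "real (Suc i) \<le> real (Suc j) * 2 ^ e"
      by (metis of_nat_le_iff of_nat_mult of_nat_numeral of_nat_power)+
    then have "real j * 2 ^ e / 2 ^ m \<le> real i / 2 ^ m" "real (Suc i) / 2 ^ m \<le> real (Suc j) * 2 ^ e / 2 ^ m"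
      by (intro divide_right_mono; simp)+
    moreover have "real l / 2 ^ n = real l * 2 ^ e / 2 ^ m" for l by (simp add: m_def power_add)
    ultimately have sub: "real j / 2 ^ n \<le> real i / 2 ^ m" "real (Suc i) / 2 ^ m \<le> real (Suc j) / 2 ^ n"
      by (simp_all only:)
    have le: "real i / 2 ^ m \<le> real (Suc i) / 2 ^ m" "real j / 2 ^ n \<le> real (Suc j) / 2 ^ n"
      by (simp_all add: divide_right_mono)
    have aff: "f t = f (real i / 2 ^ m) + 2 powi k j * (t - real i / 2 ^ m)"
      if "t \<in> {real i / 2 ^ m..real (Suc i) / 2 ^ m}" for t
      using that sub le by (intro k[OF j]) auto
    have "r j + nat (k j) \<le> e"
      unfolding e_def using j by (intro member_le_sum) auto
    then have m: "k j + int (r j) \<le> int m" by (simp add: m_def)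
    define q where "q = nat (int m - k j)"
    have "f (real i / 2 ^ m) = 2 powi k j * (real i / 2 ^ m) + d j"
      using k[OF j, of "real j / 2 ^ n" "real i / 2 ^ m"] sub le by (simp add: d_def algebra_simps)
    moreover have "2 powi k j = (2 powi (int m - int q) :: real)" using m by (simp add: q_def)
    then have "2 powi k j = (2 ^ m / 2 ^ q :: real)" by (simp add: power_int_diff)
    ultimately have "f (real i / 2 ^ m) * 2 ^ q = real i + d j * 2 ^ q" by (simp add: field_simps)
    also have "\<dots> \<in> \<int>"
      using Ints_times_power2_mono[OF r[OF j], of q] m by (intro Ints_add) (auto simp: q_def)
    finally have int: "f (real i / 2 ^ m) * 2 ^ nat (int m - k j) \<in> \<int>" by (simp add: q_def)
    have "real i < 2 ^ m" using i by (metis of_nat_less_iff of_nat_numeral of_nat_power)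
    then have "f (real i / 2 ^ m) \<in> {0..<1}" by (intro thompson_less_1[OF f]) auto
    then obtain p q where "f (real i / 2 ^ m) = real p / 2 ^ q" "p < 2 ^ q" "2 powi k j = (2 ^ m / 2 ^ q :: real)"
      using dyadic_image_interval[OF _ int] m by auto
    then show ?thesis using aff by (intro exI[of _ p] exI[of _ q]) auto
  qed
  then show ?thesis by blast
qed

text \<open>\<open>T\<close> is the complete tree of depth m, and the leaves of \<open>U\<close> are
  the words of the image intervals; these tile [0,1] because adjacent cells have adjacent
  images.\<close>

lemma thompson_represents:
  assumes f: "f \<in> thompson_elements"
  shows "\<exists>T U. represents T U f"
proof -
  obtain m where m: "\<And>i. i < 2 ^ m \<Longrightarrow> \<exists>p q. f (real i / 2 ^ m) = real p / 2 ^ q \<and> p < 2 ^ q \<and>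
    (\<forall>t\<in>{real i / 2 ^ m..real (Suc i) / 2 ^ m}. f t = f (real i / 2 ^ m) + 2 ^ m / 2 ^ q * (t - real i / 2 ^ m))"
    using thompson_subdivision[OF f] by blast
  have "\<exists>w. word_val w = f (real i / 2 ^ m) \<and> (\<forall>t\<in>{real i / 2 ^ m..real (Suc i) / 2 ^ m}.
      f t = f (real i / 2 ^ m) + 2 ^ m / 2 ^ length w * (t - real i / 2 ^ m))" if "i < 2 ^ m" for i
    using m[OF that] by (metis ex_word_val)
  then obtain w where w: "\<And>i. i < 2 ^ m \<Longrightarrow> word_val (w i) = f (real i / 2 ^ m)"
    "\<And>i t. i < 2 ^ m \<Longrightarrow> t \<in> {real i / 2 ^ m..real (Suc i) / 2 ^ m} \<Longrightarrow>
      f t = f (real i / 2 ^ m) + 2 ^ m / 2 ^ length (w i) * (t - real i / 2 ^ m)" by metis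
  obtain v where v: "\<And>i. i < 2 ^ m \<Longrightarrow> length (v i) = m" "\<And>i. i < 2 ^ m \<Longrightarrow> word_val (v i) = real i / 2 ^ m"
    using ex_word_val[of _ m] by metis
  have "\<exists>T. leaves T = map v [0..<2 ^ m]"
    by (rule ex_tree_of_partition[where x = "\<lambda>i. real i / 2 ^ m"]) (auto simp: v field_simps)
  then obtain T where T: "leaves T = map v [0..<2 ^ m]" ..
  have "\<exists>U. leaves U = map w [0..<2 ^ m]"
  proof (rule ex_tree_of_partition[where x = "\<lambda>i. f (real i / 2 ^ m)"])
    fix i :: nat assume i: "i < 2 ^ m"
    have "f (real (Suc i) / 2 ^ m) = f (real i / 2 ^ m) + 2 ^ m / 2 ^ length (w i) * (real (Suc i) / 2 ^ m - real i / 2 ^ m)"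
      by (rule w(2)[OF i]) (auto simp: divide_right_mono)
    then show "f (real (Suc i) / 2 ^ m) = f (real i / 2 ^ m) + 1 / 2 ^ length (w i)"
      by (simp add: field_simps)
  qed (use w thompson_endpoints[OF f] in auto)
  then obtain U where U: "leaves U = map w [0..<2 ^ m]" ..
  have "f (bin_val (v i @- s)) = bin_val (w i @- s)" if i: "i < 2 ^ m" for i s
  proof -
    have "f (real i / 2 ^ m + bin_val s / 2 ^ m) =
        f (real i / 2 ^ m) + 2 ^ m / 2 ^ length (w i) * (real i / 2 ^ m + bin_val s / 2 ^ m - real i / 2 ^ m)"
      by (rule w(2)[OF i]) (use bin_val_bounds[of s] in \<open>auto simp: add_divide_distrib[symmetric] divide_right_mono\<close>)
    then show ?thesis by (simp add: bin_val_shift v[OF i] w(1)[OF i])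
  qed
  then have "represents T U f" by (simp add: represents_def T U)
  then show ?thesis by blast
qed

section \<open>The even part of the planar 3-colorable subgroup\<close>

text \<open>Taking the germ on the right settles break points and matches half-open leaf intervals.
  The germ determines k, so the existential quantifier hides no choice.\<close>

definition even_at :: "(real \<Rightarrow> real) \<Rightarrow> real \<Rightarrow> bool" where
  "even_at f t \<longleftrightarrow> (\<exists>k::int. (\<exists>\<delta>>0. \<forall>x\<in>{t..<t + \<delta>}. f x = f t + 2 powi k * (x - t)) \<and>
    (even k \<longleftrightarrow> (1 / 2 \<le> t \<longleftrightarrow> 1 / 2 \<le> f t)))"

section \<open>Germs compared with diagrams and with the slopes at 0 and 1\<close>

lemma powi_2_inject: "2 powi k = (2 powi l :: real) \<longleftrightarrow> k = l"
  using power_int_strict_increasing[of k l "2::real"] power_int_strict_increasing[of l k "2::real"]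
  by (metis less_irrefl linorder_less_linear one_less_numeral_iff semiring_norm(76))

lemma log_2_powi: "log 2 (2 powi k) = of_int k"
proof -
  have "2 powi k = 2 powr real_of_int k" by (rule powr_real_of_int'[symmetric]) auto
  then show ?thesis by simp
qed

lemma even_at_iff:
  assumes "0 < \<delta>" "\<And>x. x \<in> {t..<t + \<delta>} \<Longrightarrow> f x = f t + 2 powi (k::int) * (x - t)"
  shows "even_at f t \<longleftrightarrow> (even k \<longleftrightarrow> (1 / 2 \<le> t \<longleftrightarrow> 1 / 2 \<le> f t))"
proof -
  have "l = k" if "\<epsilon> > 0" "\<forall>x\<in>{t..<t + \<epsilon>}. f x = f t + 2 powi l * (x - t)" for l :: int and \<epsilon>
  proof -
    \<comment> \<open>A point strictly to the right of t at which both affine formulas are valid and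
      can be compared.\<close>
    let ?x = "t + min \<delta> \<epsilon> / 2"
    have "f ?x = f t + 2 powi k * (?x - t)" using assms(1) that(1) by (intro assms(2)) auto
    moreover have "f ?x = f t + 2 powi l * (?x - t)" using assms(1) that(1) by (intro that(2)[rule_format]) auto
    moreover have "min \<delta> \<epsilon> \<noteq> 0" using assms(1) that(1) by simp
    ultimately show ?thesis by (simp add: powi_2_inject)
  qed
  then show ?thesis using assms unfolding even_at_def by blast
qed

text \<open>Where a leaf a is mapped to b, the slope is 2^(|a|-|b|) and the halves of t and f t are
  given by the first digits, so any single point of the interval decides whether the signs agree.
  The one-leaf tree is excluded because its leaf has no first digit.\<close>

lemma even_at_represents:
  assumes "represents T U f" "length (leaves T) \<noteq> 1" "k < length (leaves T)"
    and "word_val (leaves T ! k) \<le> t" "t < word_val (leaves T ! k) + 1 / 2 ^ length (leaves T ! k)"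
  shows "even_at f t \<longleftrightarrow> leaf_sign (leaves T ! k) = leaf_sign (leaves U ! k)"
proof -
  let ?a = "leaves T ! k" and ?b = "leaves U ! k"
  have len: "length (leaves U) = length (leaves T)" using assms(1) by (simp add: represents_def)
  have ne: "?a \<noteq> []" "?b \<noteq> []" using leaf_not_Nil assms(2,3) len by auto
  define K where "K = int (length ?a) - int (length ?b)"
  have aff: "f x = word_val ?b + 2 powi K * (x - word_val ?a)"
    if "word_val ?a \<le> x" "x < word_val ?a + 1 / 2 ^ length ?a" for x
    unfolding K_def using that by (intro represents_affine[OF assms(1,3)]) auto
  have "even_at f t \<longleftrightarrow> (even K \<longleftrightarrow> (1 / 2 \<le> t \<longleftrightarrow> 1 / 2 \<le> f t))"
  proof (rule even_at_iff)
    show "0 < word_val ?a + 1 / 2 ^ length ?a - t" using assms(5) by simp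
    show "f x = f t + 2 powi K * (x - t)" if "x \<in> {t..<t + (word_val ?a + 1 / 2 ^ length ?a - t)}" for x
      using aff[of x] aff[of t] that assms(4,5) by (simp add: algebra_simps)
  qed
  moreover have "1 / 2 \<le> t \<longleftrightarrow> hd ?a" using half_le_word_interval_iff[OF ne(1) assms(4,5)] .
  moreover have "1 / 2 \<le> f t \<longleftrightarrow> hd ?b"
  proof (rule half_le_word_interval_iff[OF ne(2)])
    show "word_val ?b \<le> f t" using aff[OF assms(4,5)] assms(4) by simp
    have "t - word_val ?a < 1 / 2 ^ length ?a" using assms(5) by linarith
    then have "2 powi K * (t - word_val ?a) < 2 powi K * (1 / 2 ^ length ?a)"
      by (rule mult_strict_left_mono) simp
    also have "\<dots> = 1 / 2 ^ length ?b" by (simp add: K_def power_int_diff)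
    finally show "f t < word_val ?b + 1 / 2 ^ length ?b" using aff[OF assms(4,5)] by simp
  qed
  ultimately show ?thesis by (auto simp: leaf_sign_eq_iff K_def)
qed

lemma affine_has_real_derivative:
  fixes f :: "real \<Rightarrow> real"
  assumes "\<And>x. x \<in> S \<Longrightarrow> f x = f c + s * (x - c)" "c \<in> S"
  shows "(f has_real_derivative s) (at c within S)"
proof -
  have "((\<lambda>x. f c + s * (x - c)) has_real_derivative s) (at c within S)"
    by (auto intro!: derivative_eq_intros)
  then show ?thesis
    by (rule has_field_derivative_transform_within[OF _ zero_less_one assms(2) assms(1)[symmetric]])
qed

text \<open>The one-sided derivative at 0 is unique, hence it is the slope of the first affine
  piece; as f 0 = 0, the halves agree and the exponent must be even.\<close>

lemma even_at_0_if_K22: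
  assumes f: "f \<in> K22"
  shows "even_at f 0"
proof -
  have F: "f \<in> thompson_elements" using f by (simp add: K22_def thompson_F_def)
  then obtain B where B: "finite B" "affine_off B f" by (auto simp: thompson_elements_iff)
  obtain e where e: "0 < e" "e \<le> 1" "{0<..<e} \<inter> B = {}" using ex_gap_right[OF B(1), of 0 1] by auto
  obtain k :: int where k: "\<And>s t. s \<in> {0..e} \<Longrightarrow> t \<in> {0..e} \<Longrightarrow> f t = f s + 2 powi k * (t - s)"
    using affine_offD[OF B(2) order_refl e(1-3)] by blast
  obtain D and m :: int where D: "(f has_real_derivative D) (at 0 within {0..1})" "log 2 D = 2 * of_int m"
    using f by (auto simp: K22_def)
  have "(f has_real_derivative 2 powi k) (at 0 within {0..e})"
    by (rule affine_has_real_derivative, rule k) (use e in auto)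
  then have "((\<lambda>y. (f y - f 0) / (y - 0)) \<longlongrightarrow> 2 powi k) (at_right 0)"
    using e(1) by (simp add: has_field_derivative_iff at_within_Icc_at_right)
  moreover have "((\<lambda>y. (f y - f 0) / (y - 0)) \<longlongrightarrow> D) (at_right 0)"
    using D(1) by (simp add: has_field_derivative_iff at_within_Icc_at_right)
  ultimately have "D = 2 powi k" using tendsto_unique trivial_limit_at_right_real by blast
  then have "real_of_int k = real_of_int (2 * m)" using D(2) by (simp add: log_2_powi)
  then have "even k" unfolding of_int_eq_iff by simp
  moreover have "even_at f 0 \<longleftrightarrow> (even k \<longleftrightarrow> (1 / 2 \<le> (0::real) \<longleftrightarrow> 1 / 2 \<le> f 0))"
    by (rule even_at_iff[of e], use e in simp, rule k) (use e in auto)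
  ultimately show ?thesis using thompson_endpoints(1)[OF F] by simp
qed

text \<open>The germ at 0 equates the signs of the first leaves, and the coloring carries this
  equality to the leaf containing t.\<close>

lemma even_at_if_E_EVEN:
  assumes f: "f \<in> E_EVEN" and t: "t \<in> {0..<1}"
  shows "even_at f t"
proof -
  obtain T U where TU: "represents T U f" "three_colorable T U"
    using f by (auto simp: E_EVEN_def planar_3_colorable_def)
  have len: "length (leaves T) = length (leaves U)" using TU(1) by (simp add: represents_def)
  obtain k where k: "k < length (leaves T)" "word_val (leaves T ! k) \<le> t"
    "t < word_val (leaves T ! k) + 1 / 2 ^ length (leaves T ! k)"
    using ex_leaf_interval[of t T] t by auto
  show ?thesis
  proof (cases "length (leaves T) = 1")
    case True
    \<comment> \<open>The one-leaf diagram represents the identity, whose germs have exponent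
      0.\<close>
    then have "T = Tip" "U = Tip" using length_leaves_eq_1 len by auto
    then have "f x = x" if "x \<in> {0..1}" for x
      using represents_affine[OF TU(1), of 0 x] that by simp
    then show ?thesis using t unfolding even_at_def
      by (intro exI[of _ 0] conjI exI[of _ "1 - t"]) auto
  next
    case False
    then have ne: "T \<noteq> Tip" "U \<noteq> Tip" using len by auto
    have "even_at f 0" using f even_at_0_if_K22 by (simp add: E_EVEN_def)
    then have "leaf_sign (leaves T ! 0) = leaf_sign (leaves U ! 0)"
      using even_at_represents[OF TU(1) False, of 0 0] length_leaves_pos[of T] by (simp add: word_val_first_leaf)
    then have "leaf_sign (leaves T ! k) = leaf_sign (leaves U ! k)"
      using three_colorable_leaf_sign[OF TU(2) len ne] k(1) by blast
    then show ?thesis using even_at_represents[OF TU(1) False k] by simp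
  qed
qed

lemma K22_if_even_at:
  assumes F: "f \<in> thompson_elements" and ev: "\<And>t. t \<in> {0..<1} \<Longrightarrow> even_at f t"
  shows "f \<in> K22"
proof -
  obtain B where B: "finite B" "affine_off B f" using F by (auto simp: thompson_elements_iff)
  have log: "log 2 (2 powi (2 * m)) = 2 * of_int m" for m :: int by (simp add: log_2_powi)
  have "\<exists>D (m::int). (f has_real_derivative D) (at 0 within {0..1}) \<and> log 2 D = 2 * of_int m"
  proof -
    obtain e where e: "0 < e" "e \<le> 1" "{0<..<e} \<inter> B = {}" using ex_gap_right[OF B(1), of 0 1] by auto
    obtain k :: int where k: "\<And>s t. s \<in> {0..e} \<Longrightarrow> t \<in> {0..e} \<Longrightarrow> f t = f s + 2 powi k * (t - s)"
      using affine_offD[OF B(2) order_refl e(1-3)] by blast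
    have "even_at f 0 \<longleftrightarrow> (even k \<longleftrightarrow> (1 / 2 \<le> (0::real) \<longleftrightarrow> 1 / 2 \<le> f 0))"
      by (rule even_at_iff[of e], use e in simp, rule k) (use e in auto)
    then have "even k" using ev[of 0] thompson_endpoints(1)[OF F] by simp
    then obtain m where m: "k = 2 * m" by blast
    have "(f has_real_derivative 2 powi k) (at 0 within {0..e})"
      by (rule affine_has_real_derivative, rule k) (use e in auto)
    then have "(f has_real_derivative 2 powi k) (at 0 within {0..1})"
      using e(1) by (simp add: at_within_Icc_at_right)
    then show ?thesis using log m by blast
  qed
  moreover have "\<exists>D (m::int). (f has_real_derivative D) (at 1 within {0..1}) \<and> log 2 D = 2 * of_int m"
  proof -
    obtain e where e: "0 \<le> e" "e < 1" "{e<..<1} \<inter> B = {}" using ex_gap_left[OF B(1), of 0 1] by auto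
    obtain k :: int where k: "\<And>s t. s \<in> {e..1} \<Longrightarrow> t \<in> {e..1} \<Longrightarrow> f t = f s + 2 powi k * (t - s)"
      using affine_offD[OF B(2) e(1,2) order_refl e(3)] by blast
    have "1 / 2 \<in> f ` {0..1}" unfolding thompson_image[OF F] by simp
    then obtain s where s: "s \<in> {0..1}" "f s = 1 / 2" by (metis imageE)
    have "s \<noteq> 1" using s(2) thompson_endpoints(2)[OF F] by auto
    \<comment> \<open>At this point the last affine piece has begun and both t and f t are at least
      1/2, so the condition on the germ forces an even exponent.\<close>
    define t where "t = Max {e, 1 / 2, s}"
    have t: "e \<le> t" "1 / 2 \<le> t" "s \<le> t" "t < 1" "0 \<le> t" using e(1,2) s(1) \<open>s \<noteq> 1\<close> by (auto simp: t_def)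
    then have "1 / 2 \<le> f t" using thompson_mono(2)[OF F, of s t] s by auto
    moreover have "even_at f t \<longleftrightarrow> (even k \<longleftrightarrow> (1 / 2 \<le> t \<longleftrightarrow> 1 / 2 \<le> f t))"
      by (rule even_at_iff[of "1 - t"], use t in simp, rule k) (use t in auto)
    ultimately have "even k" using ev[of t] t by simp
    then obtain m where m: "k = 2 * m" by blast
    have "(f has_real_derivative 2 powi k) (at 1 within {e..1})"
      by (rule affine_has_real_derivative, rule k) (use e in auto)
    then have "(f has_real_derivative 2 powi k) (at 1 within {0..1})"
      using e(2) by (simp add: at_within_Icc_at_left)
    then show ?thesis using log m by blast
  qed
  ultimately show ?thesis using F by (simp add: K22_def thompson_F_def)
qed

text \<open>Each leaf is tested at the left end of its interval, a point below 1.\<close>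

lemma planar_3_colorable_if_even_at:
  assumes F: "f \<in> thompson_elements" and ev: "\<And>t. t \<in> {0..<1} \<Longrightarrow> even_at f t"
  shows "f \<in> planar_3_colorable"
proof -
  obtain T U where TU: "represents T U f" using thompson_represents[OF F] by blast
  have len: "length (leaves T) = length (leaves U)" using TU by (simp add: represents_def)
  have "leaf_sign (leaves T ! k) = leaf_sign (leaves U ! k)" if k: "k < length (leaves T)" for k
  proof (cases "length (leaves T) = 1")
    case True
    then have "T = Tip" "U = Tip" using length_leaves_eq_1 len by auto
    then show ?thesis by simp
  next
    case False
    let ?t = "word_val (leaves T ! k)"
    have lt: "?t < ?t + 1 / 2 ^ length (leaves T ! k)" by simp
    then have "?t < 1" using word_val_end_le by (rule less_le_trans)
    then have "?t \<in> {0..<1}" using word_val_nonneg by simp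
    then show ?thesis using ev even_at_represents[OF TU False k _ lt] by simp
  qed
  then have "three_colorable T U" using len by (intro three_colorableI) auto
  then show ?thesis using TU F by (auto simp: planar_3_colorable_def thompson_F_def)
qed

text \<open>Trades diagrams and colorings for a pointwise condition, so that the remaining closure
  properties become local.\<close>

lemma E_EVEN_iff:
  "f \<in> E_EVEN \<longleftrightarrow> f \<in> thompson_elements \<and> (\<forall>t\<in>{0..<1}. even_at f t)"
proof (intro iffI conjI)
  assume f: "f \<in> E_EVEN"
  then show "f \<in> thompson_elements" by (simp add: E_EVEN_def K22_def thompson_F_def)
  show "\<forall>t\<in>{0..<1}. even_at f t" using even_at_if_E_EVEN[OF f] by blast
next
  assume "f \<in> thompson_elements \<and> (\<forall>t\<in>{0..<1}. even_at f t)"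
  then have "f \<in> K22" "f \<in> planar_3_colorable"
    using K22_if_even_at planar_3_colorable_if_even_at by blast+
  then show "f \<in> E_EVEN" by (simp add: E_EVEN_def)
qed

section \<open>Stability of the condition on germs\<close>

lemma even_at_compose:
  assumes f: "even_at f t" and g: "even_at g (f t)"
  shows "even_at (\<lambda>x. g (f x)) t"
proof -
  obtain k :: int and \<delta> where k: "\<delta> > 0" "\<And>x. x \<in> {t..<t + \<delta>} \<Longrightarrow> f x = f t + 2 powi k * (x - t)"
    "even k \<longleftrightarrow> (1 / 2 \<le> t \<longleftrightarrow> 1 / 2 \<le> f t)" using f unfolding even_at_def by metis
  obtain l :: int and \<epsilon> where l: "\<epsilon> > 0" "\<And>y. y \<in> {f t..<f t + \<epsilon>} \<Longrightarrow> g y = g (f t) + 2 powi l * (y - f t)"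
    "even l \<longleftrightarrow> (1 / 2 \<le> f t \<longleftrightarrow> 1 / 2 \<le> g (f t))" using g unfolding even_at_def by metis
  \<comment> \<open>Dividing \<epsilon> by the slope of \<open>f\<close> makes \<open>f\<close> map
    the interval into the one where the formula for \<open>g\<close> holds.\<close>
  define \<eta> where "\<eta> = min \<delta> (\<epsilon> / 2 powi k)"
  have "g (f x) = g (f t) + 2 powi (l + k) * (x - t)" if x: "x \<in> {t..<t + \<eta>}" for x
  proof -
    have fx: "f x = f t + 2 powi k * (x - t)" using x by (intro k(2)) (auto simp: \<eta>_def)
    have "x - t < \<epsilon> / 2 powi k" using x by (auto simp: \<eta>_def)
    then have "2 powi k * (x - t) < \<epsilon>" by (simp add: field_simps)
    then have "f x \<in> {f t..<f t + \<epsilon>}" using x by (simp add: fx)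
    then show ?thesis using l(2)[of "f x"] by (simp add: fx power_int_add mult.assoc)
  qed
  moreover have "\<eta> > 0" using k(1) l(1) by (simp add: \<eta>_def)
  \<comment> \<open>The sum is even iff the parities agree, and the two equivalences about halves
    chain through f t.\<close>
  moreover have "even (l + k) \<longleftrightarrow> (1 / 2 \<le> t \<longleftrightarrow> 1 / 2 \<le> g (f t))" using k(3) l(3) by auto
  ultimately show ?thesis unfolding even_at_def by blast
qed

lemma even_at_inverse:
  assumes f: "even_at f t" and gf: "\<And>x. g (f x) = x"
  shows "even_at g (f t)"
proof -
  obtain k :: int and \<delta> where k: "\<delta> > 0" "\<And>x. x \<in> {t..<t + \<delta>} \<Longrightarrow> f x = f t + 2 powi k * (x - t)"
    "even k \<longleftrightarrow> (1 / 2 \<le> t \<longleftrightarrow> 1 / 2 \<le> f t)" using f unfolding even_at_def by metis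
  \<comment> \<open>\<open>f\<close> maps an interval of length \<delta> onto one of length 2^k *
    \<delta>, on which the inverse has the opposite exponent.\<close>
  have "g y = g (f t) + 2 powi (- k) * (y - f t)" if y: "y \<in> {f t..<f t + 2 powi k * \<delta>}" for y
  proof -
    define x where "x = t + 2 powi (- k) * (y - f t)"
    have "2 powi k * (x - t) = y - f t" by (simp add: x_def power_int_minus)
    moreover have "x \<in> {t..<t + \<delta>}" using y by (auto simp: x_def power_int_minus field_simps)
    ultimately have "f x = y" using k(2)[of x] by simp
    then have "g y = x" using gf by blast
    then show ?thesis by (simp add: x_def gf)
  qed
  moreover have "2 powi k * \<delta> > 0" using k(1) by simp
  moreover have "even (- k) \<longleftrightarrow> (1 / 2 \<le> f t \<longleftrightarrow> 1 / 2 \<le> g (f t))" using k(3) gf by auto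
  ultimately show ?thesis unfolding even_at_def by blast
qed

lemma even_at_id: "even_at (\<lambda>t. t) t"
  unfolding even_at_def by (intro exI[of _ 0] conjI exI[of _ 1]) auto

lemma even_at_cong:
  assumes "even_at f t" "\<epsilon> > 0" "\<And>x. x \<in> {t..<t + \<epsilon>} \<Longrightarrow> g x = f x"
  shows "even_at g t"
proof -
  obtain k :: int and \<delta> where k: "\<delta> > 0" "\<And>x. x \<in> {t..<t + \<delta>} \<Longrightarrow> f x = f t + 2 powi k * (x - t)"
    "even k \<longleftrightarrow> (1 / 2 \<le> t \<longleftrightarrow> 1 / 2 \<le> f t)" using assms(1) unfolding even_at_def by metis
  have gt: "g t = f t" using assms(2,3) by simp
  have "g x = g t + 2 powi k * (x - t)" if "x \<in> {t..<t + min \<delta> \<epsilon>}" for x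
  proof -
    have "x \<in> {t..<t + \<delta>}" "x \<in> {t..<t + \<epsilon>}" using that by auto
    then show ?thesis using k(2)[of x] assms(3)[of x] gt by simp
  qed
  moreover have "min \<delta> \<epsilon> > 0" using k(1) assms(2) by simp
  ultimately show ?thesis using k(3) unfolding even_at_def gt by blast
qed

text \<open>The right germ of the glued map is that of \<open>f\<close> below \<alpha> and that of
  \<open>g\<close> from \<alpha> on, so the condition is inherited at every point.\<close>

lemma E_EVEN_glue:
  assumes f: "f \<in> E_EVEN" and g: "g \<in> E_EVEN"
    and \<alpha>: "\<alpha> \<in> dyadics \<inter> {0<..<1}" "f \<alpha> = \<alpha>" "g \<alpha> = \<alpha>"
  shows "(\<lambda>t. if t \<le> \<alpha> then f t else g t) \<in> E_EVEN" (is "?u \<in> _")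
  unfolding E_EVEN_iff
proof (intro conjI ballI)
  show "?u \<in> thompson_elements" using f g \<alpha> by (intro thompson_glue) (auto simp: E_EVEN_iff)
  fix t :: real assume t: "t \<in> {0..<1}"
  show "even_at ?u t"
  proof (cases "t < \<alpha>")
    case True
    have "even_at f t" using f t by (simp add: E_EVEN_iff)
    then show ?thesis by (rule even_at_cong[of _ _ "\<alpha> - t"]) (use True in auto)
  next
    case False
    have "even_at g t" using g t by (simp add: E_EVEN_iff)
    \<comment> \<open>At \<alpha> itself the case distinction selects \<open>f\<close>, whose value
      there is that of \<open>g\<close>.\<close>
    then show ?thesis by (rule even_at_cong[of _ _ 1]) (use False \<alpha> in \<open>auto dest: antisym\<close>)
  qed
qed

lemma E_EVEN_id: "(\<lambda>t. t) \<in> E_EVEN"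
  by (simp add: E_EVEN_iff thompson_id even_at_id)

lemma E_EVEN_inverse:
  assumes "f \<in> E_EVEN"
  shows "inv\<^bsub>thompson_F\<^esub> f \<in> E_EVEN"
proof -
  have f: "f \<in> thompson_elements" using assms by (simp add: E_EVEN_iff)
  obtain g where g: "g \<in> thompson_elements" "\<And>t. g (f t) = t" "\<And>t. f (g t) = t"
    using thompson_inverse[OF f] by blast
  have "even_at g t" if "t \<in> {0..<1}" for t
    using even_at_inverse[of f "g t" g] assms that thompson_less_1[OF g(1) that] g by (simp add: E_EVEN_iff)
  then have "g \<in> E_EVEN" using g(1) by (simp add: E_EVEN_iff)
  moreover have "inv\<^bsub>thompson_F\<^esub> f = g"
    \<comment> \<open>The inverse is a definite description, so uniqueness has to be shown: a
      competitor \<open>h\<close> agrees with \<open>g\<close> because every s has the form f (g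
      s).\<close>
    unfolding m_inv_def
  proof (rule the_equality)
    show "g \<in> carrier thompson_F \<and> f \<otimes>\<^bsub>thompson_F\<^esub> g = \<one>\<^bsub>thompson_F\<^esub> \<and> g \<otimes>\<^bsub>thompson_F\<^esub> f = \<one>\<^bsub>thompson_F\<^esub>"
      using g by (simp add: thompson_F_def)
  next
    fix h assume "h \<in> carrier thompson_F \<and> f \<otimes>\<^bsub>thompson_F\<^esub> h = \<one>\<^bsub>thompson_F\<^esub> \<and> h \<otimes>\<^bsub>thompson_F\<^esub> f = \<one>\<^bsub>thompson_F\<^esub>"
    then have "h (f t) = t" for t by (simp add: thompson_F_def fun_eq_iff)
    then have "h s = g s" for s using g(3) by metis
    then show "h = g" by blast
  qed
  ultimately show ?thesis by simp
qed

theorem corollary3p6: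
  shows "closed_subgroup_F E_EVEN"
  unfolding closed_subgroup_F_def
proof (intro conjI ballI impI)
  show "subgroup E_EVEN thompson_F"
  proof
    show "E_EVEN \<subseteq> carrier thompson_F" by (auto simp: E_EVEN_iff thompson_F_def)
    show "f \<otimes>\<^bsub>thompson_F\<^esub> g \<in> E_EVEN" if "f \<in> E_EVEN" "g \<in> E_EVEN" for f g
      using that thompson_compose thompson_less_1 even_at_compose by (auto simp: E_EVEN_iff thompson_F_def)
    show "\<one>\<^bsub>thompson_F\<^esub> \<in> E_EVEN" using E_EVEN_id by (simp add: thompson_F_def)
    show "inv\<^bsub>thompson_F\<^esub> f \<in> E_EVEN" if "f \<in> E_EVEN" for f using E_EVEN_inverse[OF that] .
  qed
next
  fix h \<alpha> assume h: "h \<in> E_EVEN" "\<alpha> \<in> dyadics \<inter> {0<..<1}" "h \<alpha> = \<alpha>"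
  \<comment> \<open>Both components are gluings of \<open>h\<close> with the identity, which fixes
    every point.\<close>
  show "left_component \<alpha> h \<in> E_EVEN"
    using E_EVEN_glue[OF h(1) E_EVEN_id h(2,3)] by (simp add: left_component_def[abs_def])
  show "right_component \<alpha> h \<in> E_EVEN"
    using E_EVEN_glue[OF E_EVEN_id h(1,2) _ h(3)] by (simp add: right_component_def[abs_def])
qed

end
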